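(* Consider the system $\dot x=f(x)$, $y=h(x)$ with $f:\mathbb{R}^n\to\mathbb{R}^n$, $h:\mathbb{R}^n\to\mathbb{R}^p$, let $\mathcal{O}\subset\mathbb{R}^n$ be open and let $m$ be a positive integer. Assume the system is forward complete within $\mathcal{O}$ and there exist a sufficiently smooth function $b=(b_1,\ldots,b_p):\mathbb{R}^p\to\mathbb{C}^p$, a class $\mathcal{K}_\infty$ function $\rho$ and a positive real number $L$ such that $$|L_f^mb(h(x_1))-L_f^mb(h(x_2))|\le L\,|H(x_1)-H(x_2)|\qquad\forall(x_1,x_2)\in\mathrm{cl}(\mathcal{O})^2,$$ $$|x_1-x_2|\le\rho(|H(x_1)-H(x_2)|)\qquad\forall(x_1,x_2)\in\mathrm{cl}(\mathcal{O})^2,$$ where $H:\mathbb{R}^n\to\mathbb{C}^{m\times p}$ is the function $$H(x)=\begin{pmatrix} b_1(h(x))&\cdots&b_p(h(x))\\ L_fb_1(h(x))&\cdots&L_fb_p(h(x))\\ \vdots&&\vdots\\ L_f^{m-1}b_1(h(x))&\cdots&L_f^{m-1}b_p(h(x))\end{pmatrix}.$$ Then, for any diagonal Hurwitz complex $m\times m$ matrix $A$, there exists a real number $k^*$ such that, for any real number $k$ strictly larger than $k^*$, there exist a function $T_a^*:\mathbb{C}^{m\times p}\to\mathrm{cl}(\mathcal{O})$, left inverse on $T_a(\mathrm{cl}(\mathcal{O}))$ of the function $T_a:\mathrm{cl}(\mathcal{O})\to\mathbb{C}^{m\times p}$ defined as $$T_a(x)=-\sum_{i=1}^m(kA)^{-i}B_{1m}\,L_f^{i-1}b(h(x)),\qquad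 B_{1m}=(1,\ldots,1)^T\in\mathbb{R}^m,$$ and a function $\mathfrak{F}:\mathbb{C}^{m\times p}\to\mathbb{C}^{m\times p}$ such that, for each $x\in\mathcal{O}$ and $z\in\mathbb{C}^{m\times p}$, each solution $(X(x,t),Z(x,z,t))$, with initial condition $(x,z)$ at $t=0$, of $$\dot x=f(x),\qquad\dot z=kAz+\mathfrak{F}(z)+B_{1m}\,b(h(x))$$ is right maximally defined on $[0,\sigma^+_{\mathbb{R}^n}(x))$. Moreover, we have the implication $$\sigma^+_{\mathcal{O}}(x)=\sigma^+_{\mathbb{R}^n}(x)\ \Longrightarrow\ \lim_{t\to\sigma^+_{\mathbb{R}^n}(x)}\left|T_a^*(Z(x,z,t))-X(x,t)\right|=0 .$$
   Context: The functions $f$ and $h$ are at least locally Lipschitz, and $f,h,b$ are sufficiently smooth that all the Lie derivatives involved make sense. For $x\in\mathbb{R}^n$, $X(x,t)$ denotes the unique maximal solution of $\dot x=f(x)$ with initial condition $x$ at $t=0$. For an open set $\mathcal{O}$ and $x\in\mathcal{O}$, $(\sigma^-_{\mathcal{O}}(x),\sigma^+_{\mathcal{O}}(x))$ is the maximal interval (containing $0$) of definition of the solution $X(x,t)$ conditioned to take values in $\mathcal{O}$; in particular $(\sigma^-_{\mathbb{R}^n}(x),\sigma^+_{\mathbb{R}^n}(x))$ is its maximal interval of definition. Forward completeness within $\mathcal{O}$: for each $x\in\mathcal{O}$, $\sigma^+_{\mathcal{O}}(x)<+\infty$ implies $\sigma^+_{\mathcal{O}}(x)<\sigma^+_{\mathbb{R}^n}(x)$.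 The Lie derivative of a function $V$ is $L_fV(x)=\lim_{\tau\to0}\frac{V(X(x,\tau))-V(x)}{\tau}$, with iterates $L_f^{i+1}V=L_f(L_f^iV)$; $L_f^ib_j(h(x))$ means the $i$-th iterated Lie derivative of $b_j\circ h$ evaluated at $x$, and $L_f^ib(h(x))$ is the row vector of these for $j=1,\ldots,p$ (with $L_f^0b(h(x))=b(h(x))$, a row vector). "Left inverse on $T_a(\mathrm{cl}(\mathcal{O}))$" means $T_a^*(T_a(x))=x$ for all $x\in\mathrm{cl}(\mathcal{O})$. A class $\mathcal{K}_\infty$ function is a continuous, strictly increasing, unbounded function $\mathbb{R}_+\to\mathbb{R}_+$ vanishing at $0$. A matrix is Hurwitz if all its eigenvalues have strictly negative real part. $\mathrm{cl}$ denotes closure, and $|\cdot|$ a norm.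
   Formalization: The diagonal entries of A are assumed pairwise distinct (with a repeated entry, e.g. A = -I and m = 2 for the double integrator, T_a is not injective and the claim fails), and O is assumed nonempty (otherwise no map into cl(O) exists). *)

theory Defs
  imports "HOL-Analysis.Analysis"
begin

section \<open>Solutions of autonomous differential equations\<close>

definition ivp_solution ::
  "('a::real_normed_vector \<Rightarrow> 'a) \<Rightarrow> 'a set \<Rightarrow> 'a \<Rightarrow> real set \<Rightarrow> (real \<Rightarrow> 'a) \<Rightarrow> bool" where
  "ivp_solution g U x I \<phi> \<longleftrightarrow>
     0 \<in> I \<and> \<phi> 0 = x \<and>
     (\<forall>t\<in>I. \<phi> t \<in> U \<and> (\<phi> has_vector_derivative g (\<phi> t)) (at t within I))"

definition open_ivp_solution ::
  "('a::real_normed_vector \<Rightarrow> 'a) \<Rightarrow> 'a set \<Rightarrow> 'a \<Rightarrow> real set \<Rightarrow> (real \<Rightarrow> 'a) \<Rightarrow> bool" where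
  "open_ivp_solution g U x I \<phi> \<longleftrightarrow> open I \<and> is_interval I \<and> ivp_solution g U x I \<phi>"

text \<open>When \<open>g\<close> is locally Lipschitz and \<open>U\<close> is open, the union below is the maximal
  interval (containing 0) of definition of the solution conditioned to take values in \<open>U\<close>,
  and the definite description in \<open>flow\<close> is well defined on the maximal interval for
  \<open>U = UNIV\<close>. Outside that interval the value of \<open>flow\<close> is meaningless.\<close>

definition max_ivl :: "('a::real_normed_vector \<Rightarrow> 'a) \<Rightarrow> 'a set \<Rightarrow> 'a \<Rightarrow> real set" where
  "max_ivl g U x = \<Union>{I. \<exists>\<phi>. open_ivp_solution g U x I \<phi>}"

definition sigma_plus :: "('a::real_normed_vector \<Rightarrow> 'a) \<Rightarrow> 'a set \<Rightarrow> 'a \<Rightarrow> ereal" where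
  "sigma_plus g U x = (SUP t\<in>max_ivl g U x. ereal t)"

definition flow :: "('a::real_normed_vector \<Rightarrow> 'a) \<Rightarrow> 'a \<Rightarrow> real \<Rightarrow> 'a" where
  "flow g x t = (THE y. \<exists>I \<phi>. open_ivp_solution g UNIV x I \<phi> \<and> t \<in> I \<and> \<phi> t = y)"

definition forward_complete_within :: "('a::real_normed_vector \<Rightarrow> 'a) \<Rightarrow> 'a set \<Rightarrow> bool" where
  "forward_complete_within g U \<longleftrightarrow>
     (\<forall>x\<in>U. sigma_plus g U x < \<infinity> \<longrightarrow> sigma_plus g U x < sigma_plus g UNIV x)"

definition right_solution ::
  "('a::real_normed_vector \<Rightarrow> 'a) \<Rightarrow> 'a \<Rightarrow> ereal \<Rightarrow> (real \<Rightarrow> 'a) \<Rightarrow> bool" where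
  "right_solution g x s \<phi> \<longleftrightarrow> 0 < s \<and> ivp_solution g UNIV x {t. 0 \<le> t \<and> ereal t < s} \<phi>"

definition right_maximal_solution ::
  "('a::real_normed_vector \<Rightarrow> 'a) \<Rightarrow> 'a \<Rightarrow> ereal \<Rightarrow> (real \<Rightarrow> 'a) \<Rightarrow> bool" where
  "right_maximal_solution g x s \<phi> \<longleftrightarrow>
     right_solution g x s \<phi> \<and>
     \<not> (\<exists>s' \<psi>. s < s' \<and> right_solution g x s' \<psi> \<and>
             (\<forall>t. 0 \<le> t \<and> ereal t < s \<longrightarrow> \<psi> t = \<phi> t))"


section \<open>Lie derivatives along the flow\<close>

definition lie_quotient ::
  "('a::real_normed_vector \<Rightarrow> 'a) \<Rightarrow> ('a \<Rightarrow> 'b::real_normed_vector) \<Rightarrow> 'a \<Rightarrow> real \<Rightarrow> 'b" where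
  "lie_quotient f V x \<tau> = (V (flow f x \<tau>) - V x) /\<^sub>R \<tau>"

definition lie_deriv ::
  "('a::real_normed_vector \<Rightarrow> 'a) \<Rightarrow> ('a \<Rightarrow> 'b::real_normed_vector) \<Rightarrow> 'a \<Rightarrow> 'b" where
  "lie_deriv f V x = Lim (at 0) (lie_quotient f V x)"

definition lie_differentiable ::
  "('a::real_normed_vector \<Rightarrow> 'a) \<Rightarrow> ('a \<Rightarrow> 'b::real_normed_vector) \<Rightarrow> bool" where
  "lie_differentiable f V \<longleftrightarrow> (\<forall>x. \<exists>l. (lie_quotient f V x \<longlongrightarrow> l) (at 0))"

definition lie_iter ::
  "('a::real_normed_vector \<Rightarrow> 'a) \<Rightarrow> nat \<Rightarrow> ('a \<Rightarrow> 'b::real_normed_vector) \<Rightarrow> 'a \<Rightarrow> 'b" where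
  "lie_iter f i V = ((lie_deriv f) ^^ i) V"

text \<open>The vector \<open>(L_f^i b_1(h(x)), \<dots>, L_f^i b_p(h(x)))\<close>.\<close>

definition lie_output ::
  "(real^'n \<Rightarrow> real^'n) \<Rightarrow> (real^'n \<Rightarrow> real^'p) \<Rightarrow> (real^'p \<Rightarrow> complex^'p) \<Rightarrow> nat \<Rightarrow> real^'n
     \<Rightarrow> complex^'p" where
  "lie_output f h b i x = (\<chi> j. lie_iter f i (\<lambda>x. b (h x) $ j) x)"


section \<open>The maps \<open>H\<close> and \<open>T_a\<close>\<close>

text \<open>The linear order on the row index type serves only to enumerate the rows: the row with
  index \<open>i\<close> is the one preceded by \<open>card {..<i}\<close> others, so it carries that iterate.\<close>

definition obs_map ::
  "(real^'n \<Rightarrow> real^'n) \<Rightarrow> (real^'n \<Rightarrow> real^'p) \<Rightarrow> (real^'p \<Rightarrow> complex^'p) \<Rightarrow> real^'n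
     \<Rightarrow> complex^'p^'m::{finite,linorder}" where
  "obs_map f h b x = (\<chi> i. lie_output f h b (card {..<i}) x)"

definition diagonal_matrix :: "complex^'m^'m \<Rightarrow> bool" where
  "diagonal_matrix A \<longleftrightarrow> (\<forall>i j. i \<noteq> j \<longrightarrow> A $ i $ j = 0)"

definition hurwitz :: "complex^'m^'m \<Rightarrow> bool" where
  "hurwitz A \<longleftrightarrow> (\<forall>\<mu> v. v \<noteq> 0 \<and> A *v v = \<mu> *s v \<longrightarrow> Re \<mu> < 0)"

text \<open>Powers for the matrix product; \<open>power\<close> on this type would be componentwise.\<close>

primrec mat_power :: "complex^'m^'m \<Rightarrow> nat \<Rightarrow> complex^'m^'m" where
  "mat_power M 0 = mat 1"
| "mat_power M (Suc i) = M ** mat_power M i"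

definition B1m :: "complex^1^'m" where
  "B1m = columnvector (\<chi> i. 1)"

text \<open>For diagonal \<open>A\<close>, the map \<open>T_a\<close> is the composition of \<open>H\<close> with a Vandermonde-type matrix in
  the inverses of the diagonal entries of \<open>kA\<close>. If two diagonal entries coincide, so do two rows
  of \<open>T_a x\<close>, and \<open>T_a\<close> need not be injective even if \<open>H\<close> is.\<close>

definition Ta ::
  "(real^'n \<Rightarrow> real^'n) \<Rightarrow> (real^'n \<Rightarrow> real^'p) \<Rightarrow> (real^'p \<Rightarrow> complex^'p) \<Rightarrow> complex^'m^'m \<Rightarrow> real
     \<Rightarrow> real^'n \<Rightarrow> complex^'p^'m" where
  "Ta f h b A k x =
     - (\<Sum>i = 1..CARD('m). mat_power (matrix_inv (k *\<^sub>R A)) i ** B1m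
          ** (rowvector (lie_output f h b (i - 1) x) :: complex^'p^1))"

definition coupled_field ::
  "(real^'n \<Rightarrow> real^'n) \<Rightarrow> (real^'n \<Rightarrow> real^'p) \<Rightarrow> (real^'p \<Rightarrow> complex^'p) \<Rightarrow> complex^'m^'m \<Rightarrow> real
     \<Rightarrow> (complex^'p^'m \<Rightarrow> complex^'p^'m) \<Rightarrow> (real^'n) \<times> (complex^'p^'m)
     \<Rightarrow> (real^'n) \<times> (complex^'p^'m)" where
  "coupled_field f h b A k F = (\<lambda>(x, z).
     (f x, (k *\<^sub>R A) ** z + F z + B1m ** (rowvector (b (h x)) :: complex^'p^1)))"

definition class_K_infinity :: "(real \<Rightarrow> real) \<Rightarrow> bool" where
  "class_K_infinity \<rho> \<longleftrightarrow>
     continuous_on {0..} \<rho> \<and> strict_mono_on {0..} \<rho> \<and> \<rho> 0 = 0 \<and> \<not> bdd_above (\<rho> ` {0..})"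

end

theory Submission
  imports Defs
begin

text \<open>In the coordinates \<open>z = T_a x\<close> the observer is a copy of the system: along the flow,
  \<open>T_a\<close> solves \<open>z' = k A z + F z + B b(h x)\<close> with \<open>F (T_a x)\<close> having the rows
  \<open>- (k a_i)^(-m) L_f^m b(h x)\<close>, where the \<open>a_i\<close> are the diagonal entries of \<open>A\<close>. Up to sign,
  \<open>T_a\<close> is the Vandermonde matrix in the \<open>1 / a_i\<close> applied to \<open>H\<close> with rows scaled by
  \<open>k^(-1), \<dots>, k^(-m)\<close>, so \<open>|H x1 - H x2|\<close> is at most \<open>C k^m |T_a x1 - T_a x2|\<close> for
  \<open>k \<ge> 1\<close>. The two powers of \<open>k\<close> cancel: \<open>F\<close> is Lipschitz on the image of the closure of
  \<open>\<O>\<close> with a constant independent of \<open>k\<close>, and extends to the whole space by McShane's formula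
  in each coordinate. Hence large \<open>k\<close> makes the error \<open>Z - T_a(X)\<close> decay exponentially as long
  as \<open>X\<close> stays in \<open>\<O>\<close>, and forward completeness within \<open>\<O>\<close> turns
  \<open>\<sigma>_\<O> = \<sigma>\<close> into \<open>\<sigma> = \<infinity>\<close>.\<close>

section \<open>Lipschitz differential equations and Lipschitz extensions\<close>

text \<open>Gronwall in differential form: \<open>exp (-2 * c * t) * (e t \<bullet> e t)\<close> has
  nonpositive derivative. The sign of \<open>c\<close> is free, so the same estimate gives
  uniqueness (\<open>c\<close> a Lipschitz constant) and exponential decay of the observer error
  (\<open>c\<close> negative).\<close>

lemma norm_le_exp_of_inner_le:
  fixes e e' :: "real \<Rightarrow> 'a::real_inner"
  assumes "0 \<le> T"
    and deriv: "\<And>t. t \<in> {0..T} \<Longrightarrow> (e has_vector_derivative e' t) (at t within {0..T})"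
    and le: "\<And>t. t \<in> {0..T} \<Longrightarrow> e t \<bullet> e' t \<le> c * (norm (e t))\<^sup>2"
  shows "norm (e T) \<le> exp (c * T) * norm (e 0)"
proof -
  define V where "V t = exp (-2 * c * t) * (e t \<bullet> e t)" for t
  have V': "(V has_real_derivative
      exp (-2 * c * t) * (2 * (e t \<bullet> e' t) - 2 * c * (e t \<bullet> e t))) (at t within {0..T})"
    if "t \<in> {0..T}" for t
  proof -
    have "((\<lambda>t. e t \<bullet> e t) has_real_derivative e t \<bullet> e' t + e' t \<bullet> e t) (at t within {0..T})"
      using bounded_bilinear.has_vector_derivative[OF bounded_bilinear_inner deriv[OF that] deriv[OF that]]
      by (simp add: has_real_derivative_iff_has_vector_derivative)
    then show ?thesis
      unfolding V_def
      by (auto intro!: derivative_eq_intros simp: inner_commute algebra_simps)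
  qed
  have "V T \<le> V 0"
  proof (rule DERIV_nonpos_imp_decreasing_open[OF \<open>0 \<le> T\<close>])
    fix t assume t: "0 < t" "t < T"
    have "exp (-2 * c * t) * (2 * (e t \<bullet> e' t) - 2 * c * (e t \<bullet> e t)) \<le> 0"
      using le[of t] t by (intro mult_nonneg_nonpos) (auto simp: power2_norm_eq_inner)
    moreover have "at t within {0..T} = at t"
      using t by (intro at_within_interior) auto
    ultimately show "\<exists>y. (V has_real_derivative y) (at t) \<and> y \<le> 0"
      using V'[of t] t by auto
  next
    show "continuous_on {0..T} V"
      using V' by (meson DERIV_continuous continuous_on_eq_continuous_within)
  qed
  then have "(norm (e T))\<^sup>2 * exp (-2 * c * T) \<le> (norm (e 0))\<^sup>2"
    by (simp add: V_def power2_norm_eq_inner mult.commute)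
  then have le: "(norm (e T))\<^sup>2 * exp (-2 * c * T) * exp (2 * c * T) \<le> (norm (e 0))\<^sup>2 * exp (2 * c * T)"
    by (rule mult_right_mono) simp
  have "(norm (e T))\<^sup>2 = (norm (e T))\<^sup>2 * exp (-2 * c * T) * exp (2 * c * T)"
    by (simp add: exp_minus)
  also note le
  also have "exp (2 * c * T) = (exp (c * T))\<^sup>2"
    by (simp add: mult.assoc exp_double)
  finally have "(norm (e T))\<^sup>2 \<le> (norm (e 0))\<^sup>2 * (exp (c * T))\<^sup>2" .
  then have "(norm (e T))\<^sup>2 \<le> (exp (c * T) * norm (e 0))\<^sup>2"
    by (simp only: power_mult_distrib mult.commute)
  then show ?thesis
    by (rule power2_le_imp_le) simp
qed

text \<open>The common forcing term cancels in the difference, and Cauchy-Schwarz bounds what is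
  left. The Lipschitz condition is asked only on a set containing both curves, so that locally
  Lipschitz fields are covered too.\<close>

lemma lipschitz_ode_unique:
  fixes \<phi> \<psi> :: "real \<Rightarrow> 'a::real_inner"
  assumes "0 \<le> T"
    and lip: "N-lipschitz_on X F" 
    and X: "\<And>t. t \<in> {0..T} \<Longrightarrow> \<phi> t \<in> X \<and> \<psi> t \<in> X"
    and \<phi>: "\<And>t. t \<in> {0..T} \<Longrightarrow> (\<phi> has_vector_derivative F (\<phi> t) + c t) (at t within {0..T})"
    and \<psi>: "\<And>t. t \<in> {0..T} \<Longrightarrow> (\<psi> has_vector_derivative F (\<psi> t) + c t) (at t within {0..T})"
    and "\<phi> 0 = \<psi> 0"
  shows "\<phi> T = \<psi> T"
proof -
  have "norm (\<phi> T - \<psi> T) \<le> exp (N * T) * norm (\<phi> 0 - \<psi> 0)"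
  proof (rule norm_le_exp_of_inner_le[OF \<open>0 \<le> T\<close>])
    fix t assume t: "t \<in> {0..T}"
    show "((\<lambda>t. \<phi> t - \<psi> t) has_vector_derivative F (\<phi> t) - F (\<psi> t)) (at t within {0..T})"
      using has_vector_derivative_diff[OF \<phi>[OF t] \<psi>[OF t]] by simp
    have "(\<phi> t - \<psi> t) \<bullet> (F (\<phi> t) - F (\<psi> t)) \<le> norm (\<phi> t - \<psi> t) * norm (F (\<phi> t) - F (\<psi> t))"
      by (rule norm_cauchy_schwarz)
    also have "\<dots> \<le> norm (\<phi> t - \<psi> t) * (N * norm (\<phi> t - \<psi> t))"
      using lipschitz_on_normD[OF lip] X[OF t] by (intro mult_left_mono) auto
    finally show "(\<phi> t - \<psi> t) \<bullet> (F (\<phi> t) - F (\<psi> t)) \<le> N * (norm (\<phi> t - \<psi> t))\<^sup>2"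
      by (simp add: power2_eq_square algebra_simps)
  qed
  then show ?thesis
    using \<open>\<phi> 0 = \<psi> 0\<close> by simp
qed

text \<open>Picard iteration; substituting \<open>u t = exp (- K t) \<phi> t\<close> with \<open>K\<close> twice the Lipschitz constant
  makes the integral operator a contraction on the whole interval.\<close>

lemma lipschitz_ode_exists:
  fixes F :: "'a::euclidean_space \<Rightarrow> 'a"
  assumes "0 \<le> T" and lip0: "N-lipschitz_on UNIV F" and c: "continuous_on {0..T} c"
  obtains \<phi> where "\<phi> 0 = x0"
    "\<And>t. t \<in> {0..T} \<Longrightarrow> (\<phi> has_vector_derivative F (\<phi> t) + c t) (at t within {0..T})"
proof -
  define M where "M = N + 1"
  have M: "M > 0" using lipschitz_on_nonneg[OF lip0] by (simp add: M_def)
  have lip: "M-lipschitz_on UNIV F"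
    using lip0 by (rule lipschitz_on_mono) (auto simp: M_def)
  have contF: "continuous_on S F" for S
    using lipschitz_on_continuous_on[OF lip] continuous_on_subset by blast
  define K where "K = 2 * M"
  have K: "K > 0" using M by (simp add: K_def)
  \<comment> \<open>Clamps time to \<open>{0..T}\<close>: bounded continuous functions live on the
    whole line, so the iterates are extended by their endpoint values.\<close>
  define r where "r t = max 0 (min T t)" for t
  have r: "r t \<in> {0..T}" for t using \<open>0 \<le> T\<close> by (auto simp: r_def)
  have r_id: "t \<in> {0..T} \<Longrightarrow> r t = t" for t by (auto simp: r_def)
  have contr: "continuous_on UNIV r" unfolding r_def by (intro continuous_intros)
  \<comment> \<open>The unknown \<open>u\<close> is the weighted trajectory; the factor
    \<open>exp (K * s)\<close> removes the weight before \<open>F\<close> is applied.\<close>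
  define G where "G u s = F (exp (K * s) *\<^sub>R apply_bcontfun u s) + c s" for u s
  have contG: "continuous_on {0..T} (G u)" for u
    unfolding G_def by (intro continuous_intros c continuous_on_compose2[OF contF[of UNIV]]) auto
  have intG: "G u integrable_on {0..t}" if "t \<in> {0..T}" for u t
    using that by (intro integrable_continuous_real continuous_on_subset[OF contG]) auto
  define J where "J u t = x0 + integral {0..t} (G u)" for u t
  have J': "(J u has_vector_derivative G u t) (at t within {0..T})" if "t \<in> {0..T}" for u t
    unfolding J_def using integral_has_vector_derivative[OF contG that, of u]
    by (auto intro!: derivative_eq_intros)
  have contJ: "continuous_on {0..T} (J u)" for u
    using J' by (meson continuous_on_eq_continuous_within has_vector_derivative_continuous)
  define Q where "Q u t = exp (- K * t) *\<^sub>R J u t" for u t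
  have contQ: "continuous_on {0..T} (Q u)" for u
    unfolding Q_def by (intro continuous_intros contJ)
  have Qb: "(\<lambda>t. Q u (r t)) \<in> bcontfun" for u
  proof -
    have "continuous_on UNIV (\<lambda>t. Q u (r t))"
      using r by (intro continuous_on_compose2[OF contQ contr]) auto
    moreover have "bounded (Q u ` {0..T})"
      by (intro compact_imp_bounded compact_continuous_image contQ) auto
    then have "bounded (range (\<lambda>t. Q u (r t)))"
      by (rule bounded_subset) (use r in auto)
    ultimately show ?thesis by (simp add: bcontfun_def)
  qed
  define P where "P u = Bcontfun (\<lambda>t. Q u (r t))" for u
  have P: "apply_bcontfun (P u) t = Q u (r t)" for u t
    unfolding P_def by (simp add: Bcontfun_inverse[OF Qb])
  have contraction: "dist (P u) (P v) \<le> (1/2) * dist u v" for u v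
  proof (rule dist_bound)
    fix t
    define s where "s = r t"
    have s: "s \<in> {0..T}" using r by (simp add: s_def)
    define D where "D = dist u v"
    have "D \<ge> 0" by (simp add: D_def)
    have bnd: "norm (G u \<tau> - G v \<tau>) \<le> M * D * exp (K * \<tau>)" for \<tau>
    proof -
      have "norm (G u \<tau> - G v \<tau>) \<le> M * norm (exp (K * \<tau>) *\<^sub>R u \<tau> - exp (K * \<tau>) *\<^sub>R v \<tau>)"
        unfolding G_def using lipschitz_on_normD[OF lip] by simp
      also have "\<dots> = M * (exp (K * \<tau>) * dist (u \<tau>) (v \<tau>))"
        by (simp add: dist_norm flip: scaleR_diff_right)
      also have "\<dots> \<le> M * (exp (K * \<tau>) * D)"
        unfolding D_def using M by (intro mult_left_mono dist_bounded) auto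
      finally show ?thesis by (simp add: algebra_simps)
    qed
    \<comment> \<open>As \<open>K = 2 * M\<close>, the antiderivative carries the factor
      \<open>M / K = 1/2\<close>, which becomes the contraction constant.\<close>
    have expint: "((\<lambda>\<tau>. M * D * exp (K * \<tau>)) has_integral
        (D/2 * exp (K * s) - D/2 * exp (K * 0))) {0..s}"
    proof (rule fundamental_theorem_of_calculus)
      show "((\<lambda>\<tau>. D/2 * exp (K * \<tau>)) has_vector_derivative M * D * exp (K * \<tau>)) (at \<tau> within {0..s})" for \<tau>
        unfolding has_real_derivative_iff_has_vector_derivative[symmetric]
        by (auto intro!: derivative_eq_intros simp: K_def)
    qed (use s in auto)
    have "norm (J u s - J v s) = norm (integral {0..s} (\<lambda>\<tau>. G u \<tau> - G v \<tau>))"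
      unfolding J_def using intG[OF s] by (simp add: integral_diff)
    also have "\<dots> \<le> integral {0..s} (\<lambda>\<tau>. M * D * exp (K * \<tau>))"
      using expint bnd intG[OF s]
      by (intro integral_norm_bound_integral) (auto simp: has_integral_iff integrable_diff)
    also have "\<dots> \<le> D/2 * exp (K * s)"
      unfolding integral_unique[OF expint] using \<open>D \<ge> 0\<close> by simp
    finally have le: "norm (J u s - J v s) \<le> D/2 * exp (K * s)" .
    have "dist (P u t) (P v t) = exp (- K * s) * norm (J u s - J v s)"
      by (simp add: P Q_def s_def[symmetric] dist_norm flip: scaleR_diff_right)
    also have "\<dots> \<le> exp (- K * s) * (D/2 * exp (K * s))"
      using le by (intro mult_left_mono) auto
    also have "\<dots> = D/2"
      by (simp add: exp_minus)
    finally show "dist (P u t) (P v t) \<le> (1/2) * dist u v" by (simp add: D_def)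
  qed
  obtain u where u: "P u = u"
    using banach_fix_type[of "1/2" P] contraction by auto
  have eq: "exp (K * t) *\<^sub>R u t = J u t" if "t \<in> {0..T}" for t
  proof -
    have "u t = Q u t" using P[of u t] u r_id[OF that] by simp
    then show ?thesis by (simp add: Q_def exp_minus)
  qed
  \<comment> \<open>The solution is \<open>J u\<close>, the integral without weight; it equals
    \<open>exp (K * t) *\<^sub>R u t\<close> on \<open>{0..T}\<close> by the fixed point
    equation.\<close>
  show thesis
  proof
    show "J u 0 = x0" by (simp add: J_def)
    fix t assume t: "t \<in> {0..T}"
    show "(J u has_vector_derivative F (J u t) + c t) (at t within {0..T})"
      using J'[OF t, of u] eq[OF t] by (simp add: G_def)
  qed
qed

section \<open>Extension of Lipschitz maps\<close>

text \<open>McShane: the lower envelope of the cones \<open>g s + N * dist x s\<close> is Lipschitz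
  with the constant of the cones, and on \<open>S\<close> the cone at the point itself is the
  lowest.\<close>

lemma lipschitz_extension_real:
  fixes g :: "'a::metric_space \<Rightarrow> real"
  assumes lip: "N-lipschitz_on S g"
  obtains G where "N-lipschitz_on UNIV G" "\<And>x. x \<in> S \<Longrightarrow> G x = g x"
\<comment> \<open>A real infimum over the empty set is unspecified, hence the separate constant
  extension.\<close>
proof (cases "S = {}")
  case True
  show thesis
    by (rule that[of "\<lambda>_. 0"])
      (use True lipschitz_on_nonneg[OF lip] in \<open>auto simp: lipschitz_on_def\<close>)
next
  case False
  have N: "N \<ge> 0" using lip by (rule lipschitz_on_nonneg)
  have le: "g s \<le> g s' + N * dist s s'" if "s \<in> S" "s' \<in> S" for s s'
    using lipschitz_onD[OF lip that] by (auto simp: dist_real_def)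
  define G where "G x = (INF s\<in>S. g s + N * dist x s)" for x
  obtain s0 where s0: "s0 \<in> S" using False by auto
  \<comment> \<open>Conditional completeness of the reals requires a lower bound; one fixed base
    point \<open>s0\<close> provides it.\<close>
  have bdd: "bdd_below ((\<lambda>s. g s + N * dist x s) ` S)" for x
  proof (rule bdd_belowI2)
    fix s assume "s \<in> S"
    then have "g s0 \<le> g s + N * dist s0 s" by (rule le[OF s0])
    also have "N * dist s0 s \<le> N * (dist x s0 + dist x s)"
      using N by (intro mult_left_mono dist_triangle3)
    finally show "g s0 - N * dist x s0 \<le> g s + N * dist x s" by (simp add: algebra_simps)
  qed
  have half: "G x \<le> G y + N * dist x y" for x y
  proof -
    have "G x - N * dist x y \<le> G y"
      unfolding G_def[of y]
    proof (rule cINF_greatest[OF False])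
      fix s assume s: "s \<in> S"
      have "G x \<le> g s + N * dist x s"
        unfolding G_def using bdd s by (rule cINF_lower)
      also have "N * dist x s \<le> N * (dist x y + dist y s)"
        using N by (intro mult_left_mono dist_triangle)
      finally show "G x - N * dist x y \<le> g s + N * dist y s" by (simp add: algebra_simps)
    qed
    then show ?thesis by simp
  qed
  show thesis
  proof
    show "N-lipschitz_on UNIV G"
    proof (rule lipschitz_onI)
      show "dist (G x) (G y) \<le> N * dist x y" for x y
        using half[of x y] half[of y x] by (simp add: dist_real_def dist_commute)
    qed (rule N)
    fix x assume x: "x \<in> S"
    have "G x \<le> g x + N * dist x x"
      unfolding G_def using bdd x by (rule cINF_lower)
    moreover have "g x \<le> G x"
      unfolding G_def using le[OF x] by (intro cINF_greatest[OF False])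
    ultimately show "G x = g x" by simp
  qed
qed

text \<open>The scalar extension is applied to each coordinate; adding up the coordinates by the
  triangle inequality costs the factor \<open>DIM('b)\<close>.\<close>

lemma lipschitz_extension:
  fixes g :: "'a::metric_space \<Rightarrow> 'b::euclidean_space" and N :: real
  assumes lip: "N-lipschitz_on S g"
  obtains G where "(DIM('b) * N)-lipschitz_on UNIV G" "\<And>x. x \<in> S \<Longrightarrow> G x = g x"
proof -
  have "\<exists>G. N-lipschitz_on UNIV G \<and> (\<forall>x\<in>S. G x = g x \<bullet> i)" if i: "i \<in> Basis" for i
  proof -
    have "N-lipschitz_on S (\<lambda>x. g x \<bullet> i)"
    proof (rule lipschitz_onI)
      fix x y assume "x \<in> S" "y \<in> S"
      then have "norm (g x - g y) \<le> N * dist x y"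
        using lipschitz_onD[OF lip] by (simp add: dist_norm)
      moreover have "\<bar>(g x - g y) \<bullet> i\<bar> \<le> norm (g x - g y)"
        by (rule Basis_le_norm[OF i])
      ultimately show "dist (g x \<bullet> i) (g y \<bullet> i) \<le> N * dist x y"
        by (simp add: dist_real_def inner_diff_left)
    qed (rule lipschitz_on_nonneg[OF lip])
    then show ?thesis by (rule lipschitz_extension_real) blast
  qed
  then have "\<exists>G. \<forall>i\<in>Basis. N-lipschitz_on UNIV (G i) \<and> (\<forall>x\<in>S. G i x = g x \<bullet> i)"
    by (intro bchoice) blast
  then obtain G where G: "\<And>i. i \<in> Basis \<Longrightarrow> N-lipschitz_on UNIV (G i)"
    "\<And>i x. i \<in> Basis \<Longrightarrow> x \<in> S \<Longrightarrow> G i x = g x \<bullet> i"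
    by blast
  show thesis
  proof
    show "(DIM('b) * N)-lipschitz_on UNIV (\<lambda>x. \<Sum>i\<in>Basis. G i x *\<^sub>R i)"
    proof (rule lipschitz_onI)
      fix x y
      have "norm ((\<Sum>i\<in>Basis. G i x *\<^sub>R i) - (\<Sum>i\<in>Basis. G i y *\<^sub>R i))
          = norm (\<Sum>i\<in>Basis. (G i x - G i y) *\<^sub>R (i::'b))"
        by (simp add: sum_subtractf scaleR_diff_left)
      also have "\<dots> \<le> (\<Sum>i\<in>Basis. norm ((G i x - G i y) *\<^sub>R (i::'b)))"
        by (rule norm_sum)
      also have "\<dots> \<le> (\<Sum>i\<in>(Basis::'b set). N * dist x y)"
      proof (rule sum_mono)
        fix i :: 'b assume i: "i \<in> Basis"
        then show "norm ((G i x - G i y) *\<^sub>R i) \<le> N * dist x y"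
          using lipschitz_onD[OF G(1)[OF i], of x y] by (simp add: dist_real_def)
      qed
      finally show "dist (\<Sum>i\<in>Basis. G i x *\<^sub>R i) (\<Sum>i\<in>Basis. G i y *\<^sub>R (i::'b)) \<le> DIM('b) * N * dist x y"
        by (simp add: dist_norm)
    qed (simp add: lipschitz_on_nonneg[OF lip])
    fix x assume "x \<in> S"
    then have "(\<Sum>i\<in>Basis. G i x *\<^sub>R i) = (\<Sum>i\<in>Basis. (g x \<bullet> i) *\<^sub>R i)"
      using G(2) by (intro sum.cong) auto
    then show "(\<Sum>i\<in>Basis. G i x *\<^sub>R i) = g x"
      by (simp add: euclidean_representation)
  qed
qed

section \<open>The flow of a locally Lipschitz vector field\<close>

lemma ivp_solution_subset:
  "ivp_solution g U x I \<phi> \<Longrightarrow> J \<subseteq> I \<Longrightarrow> 0 \<in> J \<Longrightarrow> ivp_solution g U x J \<phi>"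
  unfolding ivp_solution_def by (meson has_vector_derivative_within_subset subsetD)

lemma ivp_solution_superset_range:
  "ivp_solution g U x I \<phi> \<Longrightarrow> U \<subseteq> V \<Longrightarrow> ivp_solution g V x I \<phi>"
  unfolding ivp_solution_def by blast

text \<open>Reduces every backward-in-time statement to a forward one for the field
  \<open>- g\<close>.\<close>

lemma ivp_solution_reverse:
  assumes "ivp_solution g U x I \<phi>"
  shows "ivp_solution (\<lambda>x. - g x) U x (uminus ` I) (\<lambda>t. \<phi> (- t))"
proof -
  have "((\<lambda>t. \<phi> (- t)) has_vector_derivative - g (\<phi> (- t))) (at t within uminus ` I)"
    if "t \<in> uminus ` I" for t
  proof -
    have "((\<phi> \<circ> uminus) has_vector_derivative (- 1) *\<^sub>R g (\<phi> (- t))) (at t within uminus ` I)"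
    proof (rule vector_diff_chain_within)
      show "(uminus has_vector_derivative - 1) (at t within uminus ` I)"
        by (auto intro!: derivative_eq_intros)
      show "(\<phi> has_vector_derivative g (\<phi> (- t))) (at (- t) within uminus ` uminus ` I)"
        using assms that by (auto simp: ivp_solution_def image_image)
    qed
    then show ?thesis by (simp add: o_def)
  qed
  then show ?thesis
    using assms by (auto simp: ivp_solution_def image_iff)
qed

text \<open>The pieces meet only at 0, where both one-sided derivatives equal \<open>g x\<close>; a
  limit along each of two sets is a limit along their union.\<close>

lemma ivp_solution_glue:
  assumes \<phi>: "ivp_solution g U x I \<phi>" and \<psi>: "ivp_solution g U x J \<psi>"
    and I: "I \<subseteq> {0..}" and J: "J \<subseteq> {..0}"
  shows "ivp_solution g U x (I \<union> J) (\<lambda>t. if 0 \<le> t then \<phi> t else \<psi> t)"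
proof -
  define \<xi> where "\<xi> t = (if 0 \<le> t then \<phi> t else \<psi> t)" for t
  have \<xi>I: "\<xi> t = \<phi> t" if "t \<in> I" for t using that I by (auto simp: \<xi>_def)
  have \<xi>J: "\<xi> t = \<psi> t" if "t \<in> J" for t
    using that J \<phi> \<psi> by (cases "t = 0") (auto simp: \<xi>_def ivp_solution_def)
  \<comment> \<open>At a point outside the closed half-line containing \<open>I\<close> or
    \<open>J\<close>, the filter within that set is trivial and any derivative claim along it holds
    vacuously.\<close>
  have trivial: "at t within S = bot" if "S \<subseteq> C" "closed C" "t \<notin> C" for t and S C :: "real set"
  proof -
    have "closure (S - {t}) \<subseteq> C" using that by (meson Diff_subset closure_minimal subset_trans)
    then show ?thesis using that by (auto simp: at_within_eq_bot_iff)
  qed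
  have dI: "(\<xi> has_vector_derivative g (\<xi> t)) (at t within I)" if "t \<in> I \<union> J" for t
  proof (cases "t \<in> I")
    case True
    then have "(\<phi> has_vector_derivative g (\<xi> t)) (at t within I)"
      using \<phi> \<xi>I by (simp add: ivp_solution_def)
    then show ?thesis
      by (rule has_vector_derivative_transform[OF True, rotated]) (rule \<xi>I)
  next
    case False
    then have "t \<in> J" "t \<noteq> 0" using that \<phi> by (auto simp: ivp_solution_def)
    then have "t \<notin> {0..}" using J by (auto dest!: subsetD)
    then show ?thesis
      using trivial[OF I] by (simp add: has_vector_derivative_def has_derivative_def bounded_linear_scaleR_left)
  qed
  have dJ: "(\<xi> has_vector_derivative g (\<xi> t)) (at t within J)" if "t \<in> I \<union> J" for t
  proof (cases "t \<in> J")
    case True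
    then have "(\<psi> has_vector_derivative g (\<xi> t)) (at t within J)"
      using \<psi> \<xi>J by (simp add: ivp_solution_def)
    then show ?thesis
      by (rule has_vector_derivative_transform[OF True, rotated]) (rule \<xi>J)
  next
    case False
    then have "t \<in> I" "t \<noteq> 0" using that \<psi> by (auto simp: ivp_solution_def)
    then have "t \<notin> {..0}" using I by (auto dest!: subsetD)
    then show ?thesis
      using trivial[OF J] by (simp add: has_vector_derivative_def has_derivative_def bounded_linear_scaleR_left)
  qed
  have "(\<xi> has_vector_derivative g (\<xi> t)) (at t within I \<union> J)" if "t \<in> I \<union> J" for t
    using dI[OF that] dJ[OF that]
    unfolding has_vector_derivative_def has_derivative_within by (auto intro: Lim_Un)
  moreover have "\<xi> t \<in> U" if "t \<in> I \<union> J" for t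
    using that \<phi> \<psi> \<xi>I \<xi>J by (auto simp: ivp_solution_def)
  moreover have "0 \<in> I \<union> J" "\<xi> 0 = x" using \<phi> by (auto simp: ivp_solution_def \<xi>_def)
  ultimately show ?thesis unfolding ivp_solution_def \<xi>_def by blast
qed

text \<open>\<open>local_lipschitz\<close> carries a time parameter; restricting it to the single
  time 0 makes the set of times compact as well.\<close>

lemma local_lipschitz_on_compact:
  fixes f :: "'a::heine_borel \<Rightarrow> 'b::metric_space"
  assumes "local_lipschitz (UNIV :: real set) UNIV (\<lambda>_. f)" "compact K"
  obtains N where "N-lipschitz_on K f"
proof -
  have "local_lipschitz {0::real} K (\<lambda>_. f)"
    using assms(1) by (rule local_lipschitz_subset) auto
  then obtain N where "\<And>t. t \<in> {0::real} \<Longrightarrow> N-lipschitz_on K f"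
    using local_lipschitz_compact_implies_lipschitz[of "{0::real}" K "\<lambda>_. f"] assms(2)
    by auto
  then show thesis using that by blast
qed

text \<open>As a locale, the theory of \<open>f\<close> can be interpreted again for the reversed
  field \<open>- f\<close>, which supplies the backward halves of the proofs.\<close>

locale locally_lipschitz_field =
  fixes f :: "'a::euclidean_space \<Rightarrow> 'a"
  assumes local_lipschitz: "local_lipschitz (UNIV :: real set) UNIV (\<lambda>_. f)"
begin

lemma reverse: "locally_lipschitz_field (\<lambda>x. - f x)"
  using local_lipschitz by unfold_locales (subst local_lipschitz_minus)

section \<open>Uniqueness and local existence\<close>

text \<open>Over a compact time interval both trajectories have compact image, and \<open>f\<close>
  is Lipschitz on the union of the two images.\<close>

lemma ivp_unique_forward:
  assumes "0 \<le> T" "ivp_solution f UNIV x {0..T} \<phi>" "ivp_solution f UNIV x {0..T} \<psi>"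
  shows "\<phi> T = \<psi> T"
proof -
  have \<phi>: "(\<phi> has_vector_derivative f (\<phi> t) + 0) (at t within {0..T})"
    and \<psi>: "(\<psi> has_vector_derivative f (\<psi> t) + 0) (at t within {0..T})" if "t \<in> {0..T}" for t
    using assms that by (auto simp: ivp_solution_def)
  have "continuous_on {0..T} \<phi>" "continuous_on {0..T} \<psi>"
    using \<phi> \<psi> by (meson continuous_on_eq_continuous_within has_vector_derivative_continuous)+
  then have "compact (\<phi> ` {0..T} \<union> \<psi> ` {0..T})"
    by (intro compact_Un compact_continuous_image) auto
  then obtain N where N: "N-lipschitz_on (\<phi> ` {0..T} \<union> \<psi> ` {0..T}) f"
    using local_lipschitz_on_compact[OF local_lipschitz] by metis
  show ?thesis
    by (rule lipschitz_ode_unique[OF \<open>0 \<le> T\<close> N _ \<phi> \<psi>])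
      (use assms in \<open>auto simp: ivp_solution_def\<close>)
qed

lemma ivp_unique:
  assumes \<phi>: "ivp_solution f UNIV x I \<phi>" and \<psi>: "ivp_solution f UNIV x J \<psi>"
    and int: "is_interval I" "is_interval J" and t: "t \<in> I" "t \<in> J"
  shows "\<phi> t = \<psi> t"
proof -
  have zero: "0 \<in> I" "0 \<in> J" using \<phi> \<psi> by (auto simp: ivp_solution_def)
  show ?thesis
  proof (cases "0 \<le> t")
    case True
    have "{0..t} \<subseteq> I" "{0..t} \<subseteq> J"
      using mem_is_interval_1_I[OF int(1) zero(1) t(1)] mem_is_interval_1_I[OF int(2) zero(2) t(2)] by auto
    then show ?thesis
      using ivp_unique_forward[OF True ivp_solution_subset[OF \<phi>] ivp_solution_subset[OF \<psi>]] True by simp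
  next
    case False
    interpret reversed: locally_lipschitz_field "\<lambda>x. - f x" by (rule reverse)
    have "{0..-t} \<subseteq> uminus ` S" if "is_interval S" "0 \<in> S" "t \<in> S" for S
    proof
      fix s assume s: "s \<in> {0..-t}"
      have "- s \<in> S"
        using mem_is_interval_1_I[of S t 0 "- s"] that s by simp
      then show "s \<in> uminus ` S" by (intro image_eqI[of _ _ "- s"]) auto
    qed
    then have "{0..-t} \<subseteq> uminus ` I" "{0..-t} \<subseteq> uminus ` J"
      using zero t int by auto
    then have "\<phi> (- (- t)) = \<psi> (- (- t))"
      using False ivp_solution_reverse[OF \<phi>] ivp_solution_reverse[OF \<psi>]
      by (intro reversed.ivp_unique_forward[of "-t" x]) (auto intro: ivp_solution_subset)
    then show ?thesis by simp
  qed
qed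

text \<open>Composing \<open>f\<close> with the nearest-point projection onto a ball where it is
  Lipschitz gives a globally Lipschitz field. Its solution solves the original equation as long as
  it stays in the ball, which continuity guarantees for a short time.\<close>

lemma ivp_exists_forward:
  obtains \<delta> \<phi> where "\<delta> > 0" "ivp_solution f UNIV x {0..<\<delta>} \<phi>"
proof -
  obtain u N where u: "u > 0" and N: "N-lipschitz_on (cball x u) f"
    using local_lipschitzE[OF local_lipschitz, of 0 x]
    by (metis IntI UNIV_I centre_in_cball inf_top.right_neutral less_eq_real_def)
  define F where "F = f \<circ> closest_point (cball x u)"
  have "N-lipschitz_on UNIV F"
  proof (rule lipschitz_onI)
    fix y z
    have "dist (F y) (F z) \<le> N * dist (closest_point (cball x u) y) (closest_point (cball x u) z)"
      unfolding F_def o_def using u by (intro lipschitz_onD[OF N] closest_point_in_set) auto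
    also have "\<dots> \<le> N * dist y z"
      using u lipschitz_on_nonneg[OF N] by (intro mult_left_mono closest_point_lipschitz) auto
    finally show "dist (F y) (F z) \<le> N * dist y z" .
  qed (rule lipschitz_on_nonneg[OF N])
  then obtain \<phi> where \<phi>0: "\<phi> 0 = x"
    and \<phi>: "\<And>t. t \<in> {0..1} \<Longrightarrow> (\<phi> has_vector_derivative F (\<phi> t) + 0) (at t within {0..1})"
    using lipschitz_ode_exists[of 1 N F "\<lambda>_. 0" x] by (metis continuous_on_const zero_le_one)
  have "continuous (at 0 within {0..1}) \<phi>"
    using \<phi>[of 0] has_vector_derivative_continuous by auto
  then obtain d where d: "d > 0" "\<And>t. t \<in> {0..1} \<Longrightarrow> dist t 0 < d \<Longrightarrow> dist (\<phi> t) x < u"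
    using u \<phi>0 unfolding continuous_within_eps_delta by metis
  show thesis
  proof
    show "min 1 d > 0" using d by simp
    show "ivp_solution f UNIV x {0..<min 1 d} \<phi>"
      unfolding ivp_solution_def
    proof (intro conjI ballI)
      fix t assume t: "t \<in> {0..<min 1 d}"
      have "\<phi> t \<in> cball x u" using d(2)[of t] t by (simp add: dist_commute less_imp_le)
      then have "F (\<phi> t) = f (\<phi> t)" by (simp add: F_def closest_point_self)
      moreover have "(\<phi> has_vector_derivative F (\<phi> t) + 0) (at t within {0..<min 1 d})"
        using t by (intro has_vector_derivative_within_subset[OF \<phi>]) auto
      ultimately show "(\<phi> has_vector_derivative f (\<phi> t)) (at t within {0..<min 1 d})" by simp
    qed (use d \<phi>0 in auto)
  qed
qed

lemma ivp_exists_backward: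
  obtains \<delta> \<phi> where "\<delta> > 0" "ivp_solution f UNIV x {-\<delta><..0} \<phi>"
proof -
  interpret reversed: locally_lipschitz_field "\<lambda>x. - f x" by (rule reverse)
  obtain \<delta> \<phi> where \<delta>: "\<delta> > 0" and \<phi>: "ivp_solution (\<lambda>x. - f x) UNIV x {0..<\<delta>} \<phi>"
    by (rule reversed.ivp_exists_forward)
  show thesis
    using that[OF \<delta>] ivp_solution_reverse[OF \<phi>] by simp
qed

text \<open>Right solutions live on \<open>[0, s)\<close>, whereas \<open>flow\<close> and
  \<open>max_ivl\<close> are built from open intervals around 0; a short backward piece bridges the
  two notions.\<close>

lemma open_ivp_solution_extend_left:
  assumes "right_solution f x s \<phi>"
  obtains I \<psi> where "open_ivp_solution f UNIV x I \<psi>" "{t. 0 \<le> t \<and> ereal t < s} \<subseteq> I"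
    "\<And>t. 0 \<le> t \<Longrightarrow> \<psi> t = \<phi> t"
proof -
  obtain \<delta> \<eta> where \<delta>: "\<delta> > 0" and \<eta>: "ivp_solution f UNIV x {-\<delta><..0} \<eta>"
    by (rule ivp_exists_backward)
  let ?I = "{t. 0 \<le> t \<and> ereal t < s}" and ?\<psi> = "\<lambda>t. if 0 \<le> t then \<phi> t else \<eta> t"
  have s: "0 < s" using assms by (simp add: right_solution_def)
  have eq: "?I \<union> {-\<delta><..0} = {-\<delta><..} \<inter> {t. ereal t < s}"
    using \<delta> s by (auto intro: le_less_trans[of "ereal _" 0])
  have "open {t. ereal t < s}" by (intro open_Collect_less continuous_intros)
  moreover have "is_interval ({-\<delta><..} \<inter> {t. ereal t < s})"
    by (auto simp: is_interval_1 intro: le_less_trans[of "ereal _" "ereal _"])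
  moreover have "ivp_solution f UNIV x (?I \<union> {-\<delta><..0}) ?\<psi>"
    using assms \<eta> by (intro ivp_solution_glue) (auto simp: right_solution_def)
  ultimately have "open_ivp_solution f UNIV x (?I \<union> {-\<delta><..0}) ?\<psi>"
    unfolding open_ivp_solution_def eq by auto
  then show thesis by (rule that) auto
qed

section \<open>The flow and its maximal interval\<close>

lemma flow_eq:
  assumes "open_ivp_solution f U x I \<phi>" "t \<in> I"
  shows "flow f x t = \<phi> t"
proof -
  have "open_ivp_solution f UNIV x I \<phi>"
    using assms ivp_solution_superset_range[OF _ subset_UNIV] by (auto simp: open_ivp_solution_def)
  then show ?thesis
    unfolding flow_def using assms ivp_unique
    by (intro the_equality) (auto simp: open_ivp_solution_def)
qed

text \<open>All intervals in the union contain 0, so the union is connected and thus an interval.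
  The derivative is a local matter and is inherited from any one solution defined near the given
  time.\<close>

lemma flow_open_ivp_solution: "open_ivp_solution f UNIV x (max_ivl f UNIV x) (flow f x)"
proof -
  obtain \<delta> \<phi> where "\<delta> > 0" "ivp_solution f UNIV x {0..<\<delta>} \<phi>" by (rule ivp_exists_forward)
  moreover have "{t. 0 \<le> t \<and> ereal t < ereal \<delta>} = {0..<\<delta>}" by auto
  ultimately have "right_solution f x (ereal \<delta>) \<phi>" by (simp add: right_solution_def)
  then obtain I \<psi> where I: "open_ivp_solution f UNIV x I \<psi>"
    using open_ivp_solution_extend_left by metis
  then have "I \<subseteq> max_ivl f UNIV x" and zero: "0 \<in> I"
    unfolding max_ivl_def by (blast, simp add: open_ivp_solution_def ivp_solution_def)
  have 0: "0 \<in> max_ivl f UNIV x" using \<open>I \<subseteq> _\<close> zero by blast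
  have flow0: "flow f x 0 = x"
    using flow_eq[OF I zero] I by (simp add: open_ivp_solution_def ivp_solution_def)
  have op: "open (max_ivl f UNIV x)"
    unfolding max_ivl_def by (intro open_Union) (auto simp: open_ivp_solution_def)
  have "connected (max_ivl f UNIV x)"
    unfolding max_ivl_def
    by (rule connected_Union)
      (auto simp: open_ivp_solution_def ivp_solution_def is_interval_connected_1)
  then have int: "is_interval (max_ivl f UNIV x)" by (simp add: is_interval_connected_1)
  have "(flow f x has_vector_derivative f (flow f x t)) (at t within max_ivl f UNIV x)"
    if t: "t \<in> max_ivl f UNIV x" for t
  proof -
    obtain J \<psi> where J: "open_ivp_solution f UNIV x J \<psi>" "t \<in> J"
      using t unfolding max_ivl_def by blast
    then have "(\<psi> has_vector_derivative f (\<psi> t)) (at t)"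
      by (metis at_within_open ivp_solution_def open_ivp_solution_def)
    moreover have "open J" using J by (simp add: open_ivp_solution_def)
    ultimately have "(flow f x has_vector_derivative f (\<psi> t)) (at t)"
      by (rule has_vector_derivative_transform_within_open[OF _ _ J(2)])
        (simp add: flow_eq[OF J(1)])
    then show ?thesis
      using flow_eq[OF J] by (simp add: has_vector_derivative_at_within)
  qed
  then show ?thesis
    using op int 0 flow0 by (auto simp: open_ivp_solution_def ivp_solution_def)
qed

lemma flow_zero [simp]: "flow f x 0 = x"
  and zero_in_max_ivl: "0 \<in> max_ivl f UNIV x"
  and open_max_ivl: "open (max_ivl f UNIV x)"
  and is_interval_max_ivl: "is_interval (max_ivl f UNIV x)"
  using flow_open_ivp_solution[of x] by (auto simp: open_ivp_solution_def ivp_solution_def)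

lemma flow_has_vector_derivative:
  "t \<in> max_ivl f UNIV x \<Longrightarrow> (flow f x has_vector_derivative f (flow f x t)) (at t)"
  using flow_open_ivp_solution[of x]
  by (metis at_within_open ivp_solution_def open_ivp_solution_def)

text \<open>The maximal interval is open, so its supremum is not attained and membership becomes a
  strict inequality.\<close>

lemma less_sigma_plus_iff:
  assumes "0 \<le> t"
  shows "ereal t < sigma_plus f UNIV x \<longleftrightarrow> t \<in> max_ivl f UNIV x"
proof
  assume "ereal t < sigma_plus f UNIV x"
  then obtain s where "s \<in> max_ivl f UNIV x" "t < s"
    by (auto simp: sigma_plus_def less_SUP_iff)
  then show "t \<in> max_ivl f UNIV x"
    using mem_is_interval_1_I[OF is_interval_max_ivl zero_in_max_ivl, of s x t] assms by simp
next
  assume "t \<in> max_ivl f UNIV x"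
  then obtain e where e: "e > 0" "ball t e \<subseteq> max_ivl f UNIV x"
    using open_max_ivl open_contains_ball by metis
  have "t + e/2 \<in> max_ivl f UNIV x"
    using e by (intro subsetD[OF e(2)]) (simp add: dist_real_def)
  moreover have "ereal t < ereal (t + e/2)" using e by simp
  ultimately show "ereal t < sigma_plus f UNIV x"
    unfolding sigma_plus_def less_SUP_iff by blast
qed

lemma sigma_plus_pos: "0 < sigma_plus f UNIV x"
  using less_sigma_plus_iff[of 0 x] zero_in_max_ivl by (simp add: zero_ereal_def)

lemma right_solution_le_sigma_plus:
  assumes "right_solution f x s \<phi>"
  shows "s \<le> sigma_plus f UNIV x"
    and "\<And>t. 0 \<le> t \<Longrightarrow> ereal t < s \<Longrightarrow> \<phi> t = flow f x t"
proof -
  obtain I \<psi> where I: "open_ivp_solution f UNIV x I \<psi>" "{t. 0 \<le> t \<and> ereal t < s} \<subseteq> I"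
    "\<And>t. 0 \<le> t \<Longrightarrow> \<psi> t = \<phi> t"
    using open_ivp_solution_extend_left[OF assms] by metis
  show "\<phi> t = flow f x t" if "0 \<le> t" "ereal t < s" for t
    using flow_eq[OF I(1), of t] I that by auto
  show "s \<le> sigma_plus f UNIV x"
  proof (rule ccontr)
    assume "\<not> s \<le> sigma_plus f UNIV x"
    then obtain t where t: "sigma_plus f UNIV x < ereal t" "ereal t < s"
      using ereal_dense2 by (metis not_le)
    then have "0 \<le> t" using sigma_plus_pos[of x] by (cases "0 \<le> t") (auto simp: zero_ereal_def dest: less_trans)
    then have "t \<in> max_ivl f UNIV x" using I t unfolding max_ivl_def by blast
    then show False using less_sigma_plus_iff[OF \<open>0 \<le> t\<close>, of x] t by auto
  qed
qed

text \<open>Below the common supremum some solution confined to \<open>U\<close> is still defined,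
  and the flow agrees with it.\<close>

lemma flow_in_of_sigma_plus_eq:
  assumes "sigma_plus f U x = sigma_plus f UNIV x" "0 \<le> t" "ereal t < sigma_plus f UNIV x"
  shows "flow f x t \<in> U"
proof -
  obtain s where "s \<in> max_ivl f U x" "t < s"
    using assms(3) unfolding assms(1)[symmetric] by (auto simp: sigma_plus_def less_SUP_iff)
  then obtain I \<phi> where I: "open_ivp_solution f U x I \<phi>" "s \<in> I" unfolding max_ivl_def by blast
  then have "0 \<in> I" "is_interval I" by (auto simp: open_ivp_solution_def ivp_solution_def)
  then have "t \<in> I"
    using mem_is_interval_1_I[of I 0 s t] I(2) \<open>0 \<le> t\<close> \<open>t < s\<close> by simp
  then show ?thesis
    using flow_eq[OF I(1)] I(1) by (simp add: open_ivp_solution_def ivp_solution_def)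
qed

section \<open>Derivatives along the flow\<close>

text \<open>The time-shifted trajectory solves the same equation from \<open>flow f x t\<close>.
  This local form of the group law suffices for limits as \<open>\<tau>\<close> tends to 0.\<close>

lemma eventually_flow_flow:
  assumes t: "t \<in> max_ivl f UNIV x"
  shows "\<forall>\<^sub>F \<tau> in nhds 0. flow f (flow f x t) \<tau> = flow f x (t + \<tau>)"
proof -
  let ?M = "max_ivl f UNIV x" and ?I = "(\<lambda>\<tau>. t + \<tau>) -` max_ivl f UNIV x"
  have op: "open ?I"
    by (intro open_vimage open_max_ivl continuous_intros)
  have int: "is_interval ?I"
    unfolding is_interval_1 using is_interval_max_ivl[of x, unfolded is_interval_1]
    by (metis add_le_cancel_left vimage_eq)
  have "((\<lambda>\<tau>. flow f x (t + \<tau>)) has_vector_derivative f (flow f x (t + \<tau>))) (at \<tau>)"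
    if "\<tau> \<in> ?I" for \<tau>
  proof -
    have "((flow f x \<circ> (\<lambda>\<tau>. t + \<tau>)) has_vector_derivative 1 *\<^sub>R f (flow f x (t + \<tau>))) (at \<tau>)"
      using that
      by (intro vector_diff_chain_at flow_has_vector_derivative) (auto intro!: derivative_eq_intros)
    then show ?thesis by (simp add: o_def)
  qed
  then have "open_ivp_solution f UNIV (flow f x t) ?I (\<lambda>\<tau>. flow f x (t + \<tau>))"
    using op int t by (auto simp: open_ivp_solution_def ivp_solution_def has_vector_derivative_at_within)
  then have "\<And>\<tau>. \<tau> \<in> ?I \<Longrightarrow> flow f (flow f x t) \<tau> = flow f x (t + \<tau>)"
    by (rule flow_eq)
  moreover have "\<forall>\<^sub>F \<tau> in nhds 0. \<tau> \<in> ?I"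
    using op t by (intro eventually_nhds_in_open) auto
  ultimately show ?thesis by (auto elim: eventually_mono)
qed

text \<open>By the local group law, the Lie quotient at the point \<open>flow f x t\<close> is the
  difference quotient at time \<open>t\<close> of \<open>V\<close> along the trajectory.\<close>

lemma lie_differentiable_imp_has_vector_derivative:
  assumes V: "lie_differentiable f V" and t: "t \<in> max_ivl f UNIV x"
  shows "((\<lambda>t. V (flow f x t)) has_vector_derivative lie_deriv f V (flow f x t)) (at t)"
proof -
  let ?y = "flow f x t"
  obtain l where l: "(lie_quotient f V ?y \<longlongrightarrow> l) (at 0)"
    using V by (auto simp: lie_differentiable_def)
  then have eq: "lie_deriv f V ?y = l"
    unfolding lie_deriv_def by (intro tendsto_Lim) auto
  have "\<forall>\<^sub>F \<tau> in at 0. flow f ?y \<tau> = flow f x (t + \<tau>)"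
    using eventually_flow_flow[OF t] by (simp add: eventually_nhds_conv_at)
  then have "\<forall>\<^sub>F \<tau> in at 0. lie_quotient f V ?y \<tau> = (V (flow f x (t + \<tau>)) - V ?y) /\<^sub>R \<tau>"
    by (rule eventually_mono) (simp add: lie_quotient_def)
  then have "((\<lambda>\<tau>. (V (flow f x (t + \<tau>)) - V ?y) /\<^sub>R \<tau>) \<longlongrightarrow> l) (at 0)"
    using l by (simp add: tendsto_cong)
  then have "((\<lambda>\<tau>. norm ((V (flow f x (t + \<tau>)) - V ?y) /\<^sub>R \<tau> - l)) \<longlongrightarrow> 0) (at 0)"
    by (intro tendsto_norm_zero LIM_zero)
  moreover have "\<forall>\<^sub>F \<tau> in at 0. norm ((V (flow f x (t + \<tau>)) - V ?y) /\<^sub>R \<tau> - l)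
      = norm (V (flow f x (t + \<tau>)) - V ?y - \<tau> *\<^sub>R l) / norm \<tau>"
  proof (rule eventually_mono[OF eventually_neq_at_within])
    fix \<tau> :: real assume "\<tau> \<noteq> 0"
    then have "(V (flow f x (t + \<tau>)) - V ?y) /\<^sub>R \<tau> - l
        = (V (flow f x (t + \<tau>)) - V ?y - \<tau> *\<^sub>R l) /\<^sub>R \<tau>"
      by (simp add: scaleR_diff_right)
    then show "norm ((V (flow f x (t + \<tau>)) - V ?y) /\<^sub>R \<tau> - l)
      = norm (V (flow f x (t + \<tau>)) - V ?y - \<tau> *\<^sub>R l) / norm \<tau>"
      by (simp add: divide_inverse mult.commute)
  qed
  ultimately have "((\<lambda>\<tau>. norm (V (flow f x (t + \<tau>)) - V ?y - \<tau> *\<^sub>R l) / norm \<tau>) \<longlongrightarrow> 0) (at 0)"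
    using tendsto_cong by fastforce
  then show ?thesis
    unfolding has_vector_derivative_def has_derivative_at eq
    by (simp add: bounded_linear_scaleR_left)
qed

end

section \<open>Cascades driven by the flow\<close>

text \<open>Solutions on the compact intervals \<open>{0..T}\<close> with \<open>T\<close> below
  \<open>s\<close> agree where they overlap, by uniqueness, and therefore patch together.\<close>

lemma lipschitz_ode_exists_half_open:
  fixes F :: "'a::euclidean_space \<Rightarrow> 'a"
  assumes lip: "N-lipschitz_on UNIV F" and "0 < s"
    and c: "continuous_on {t. 0 \<le> t \<and> ereal t < s} c"
  obtains Z where "Z 0 = z"
    "\<And>t. 0 \<le> t \<Longrightarrow> ereal t < s \<Longrightarrow>
      (Z has_vector_derivative F (Z t) + c t) (at t within {t. 0 \<le> t \<and> ereal t < s})"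
proof -
  let ?S = "{t. 0 \<le> t \<and> ereal t < s}"
  have sub: "{0..T} \<subseteq> ?S" if "T \<in> ?S" for T
    using that by (auto intro: le_less_trans[of "ereal _" "ereal _"])
  define sol where "sol T \<phi> \<longleftrightarrow> \<phi> 0 = z \<and>
    (\<forall>t\<in>{0..T}. (\<phi> has_vector_derivative F (\<phi> t) + c t) (at t within {0..T}))" for T \<phi>
  have "\<exists>\<phi>. sol T \<phi>" if "T \<in> ?S" for T
  proof (rule lipschitz_ode_exists[OF _ lip continuous_on_subset[OF c sub[OF that]], of z])
    show "0 \<le> T" using that by simp
  qed (auto simp: sol_def)
  then obtain \<phi> where \<phi>: "\<And>T. T \<in> ?S \<Longrightarrow> sol T (\<phi> T)" by metis
  define Z where "Z t = \<phi> t t" for t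
  have restrict: "sol T' \<psi>" if "sol T \<psi>" "T' \<le> T" for T T' \<psi>
    using that unfolding sol_def
    by (auto intro: has_vector_derivative_within_subset[where S = "{0..T}"])
  have Z: "Z t = \<phi> T t" if "T \<in> ?S" "t \<in> {0..T}" for t T
  proof -
    have "t \<in> ?S" using sub[OF that(1)] that(2) by blast
    then have "sol t (\<phi> t)" "sol t (\<phi> T)"
      using \<phi> restrict[OF \<phi>[OF that(1)], of t] that(2) by auto
    then show ?thesis
      unfolding Z_def sol_def using that(2)
      by (intro lipschitz_ode_unique[OF _ lip, of t "\<phi> t" "\<phi> T" c]) auto
  qed
  show thesis
  proof
    have "0 \<in> ?S" using \<open>0 < s\<close> by (simp add: zero_ereal_def)
    then show "Z 0 = z" using \<phi>[of 0] unfolding Z_def sol_def by blast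
    fix t assume "0 \<le> t" "ereal t < s"
    \<comment> \<open>A time strictly beyond \<open>t\<close> makes \<open>{0..T}\<close> and the
      full half-open interval coincide near \<open>t\<close>, so their derivatives agree.\<close>
    then obtain T where T: "ereal t < ereal T" "ereal T < s" using ereal_dense2 by metis
    have TS: "T \<in> ?S" using T \<open>0 \<le> t\<close> by auto
    have t: "t \<in> {0..T}" using T \<open>0 \<le> t\<close> by auto
    have "(\<phi> T has_vector_derivative F (\<phi> T t) + c t) (at t within {0..T})"
      using \<phi>[OF TS] t unfolding sol_def by blast
    then have "(Z has_vector_derivative F (Z t) + c t) (at t within {0..T})"
      unfolding Z[OF TS t]
      by (rule has_vector_derivative_transform[OF t, rotated]) (rule Z[OF TS])
    moreover have "at t within {0..T} = at t within ?S"
    proof (rule at_within_nhd)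
      show "t \<in> {..<T}" "open {..<T}" using T by auto
      show "{0..T} \<inter> {..<T} - {t} = ?S \<inter> {..<T} - {t}" using T sub[OF TS] by auto
    qed
    ultimately show "(Z has_vector_derivative F (Z t) + c t) (at t within ?S)" by simp
  qed
qed

text \<open>The driven system \<open>z' = F z + c x\<close> is globally Lipschitz, so its solution lives exactly as
  long as that of the driving one.\<close>

lemma (in locally_lipschitz_field) right_maximal_solution_cascade:
  fixes F :: "'b::euclidean_space \<Rightarrow> 'b" and c :: "'a \<Rightarrow> 'b"
  assumes lip: "N-lipschitz_on UNIV F"
    and c: "continuous_on (max_ivl f UNIV x) (\<lambda>t. c (flow f x t))"
  defines "g \<equiv> \<lambda>(x, z). (f x, F z + c x)" and "\<sigma> \<equiv> sigma_plus f UNIV x"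
  shows "\<exists>s \<phi>. right_maximal_solution g (x, z) s \<phi>"
    and "right_maximal_solution g (x, z) s \<phi> \<Longrightarrow> s = \<sigma>"
    and "right_maximal_solution g (x, z) s \<phi> \<Longrightarrow> 0 \<le> t \<Longrightarrow> ereal t < \<sigma> \<Longrightarrow>
      ((\<lambda>t. snd (\<phi> t)) has_vector_derivative F (snd (\<phi> t)) + c (flow f x t))
        (at t within {t. 0 \<le> t \<and> ereal t < \<sigma>})"
proof -
  let ?S = "\<lambda>s. {t. 0 \<le> t \<and> ereal t < s}"
  have S: "?S \<sigma> \<subseteq> max_ivl f UNIV x" using less_sigma_plus_iff by (auto simp: \<sigma>_def)
  have fst_snd: "right_solution f x s (\<lambda>t. fst (\<phi> t))"
    "0 \<le> t \<Longrightarrow> ereal t < s \<Longrightarrow> ((\<lambda>t. snd (\<phi> t)) has_vector_derivative F (snd (\<phi> t)) + c (fst (\<phi> t)))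
        (at t within ?S s)"
    if "right_solution g (x, z) s \<phi>" for s \<phi> t
  proof -
    have d: "(\<phi> has_vector_derivative (f (fst (\<phi> t)), F (snd (\<phi> t)) + c (fst (\<phi> t)))) (at t within ?S s)"
      if "t \<in> ?S s" for t
      using \<open>right_solution g (x, z) s \<phi>\<close> that
      by (auto simp: right_solution_def ivp_solution_def g_def case_prod_unfold)
    have "((\<lambda>t. fst (\<phi> t)) has_vector_derivative f (fst (\<phi> t))) (at t within ?S s)"
      if "t \<in> ?S s" for t
      using bounded_linear.has_vector_derivative[OF bounded_linear_fst d[OF that]] by simp
    then show "right_solution f x s (\<lambda>t. fst (\<phi> t))"
      using \<open>right_solution g (x, z) s \<phi>\<close> by (auto simp: right_solution_def ivp_solution_def)
    show "((\<lambda>t. snd (\<phi> t)) has_vector_derivative F (snd (\<phi> t)) + c (fst (\<phi> t)))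
        (at t within ?S s)" if "0 \<le> t" "ereal t < s"
      using bounded_linear.has_vector_derivative[OF bounded_linear_snd d[of t]] that by simp
  qed
  have le: "s \<le> \<sigma>" if "right_solution g (x, z) s \<phi>" for s \<phi>
    using right_solution_le_sigma_plus(1)[OF fst_snd(1)[OF that]] by (simp add: \<sigma>_def)
  have fst_eq: "fst (\<phi> t) = flow f x t" if "right_solution g (x, z) s \<phi>" "0 \<le> t" "ereal t < s" for s \<phi> t
    using right_solution_le_sigma_plus(2)[OF fst_snd(1)[OF that(1)]] that by simp
  have snd_deriv: "((\<lambda>t. snd (\<phi> t)) has_vector_derivative F (snd (\<phi> t)) + c (flow f x t)) (at t within ?S s)"
    if "right_solution g (x, z) s \<phi>" "0 \<le> t" "ereal t < s" for s \<phi> t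
    using fst_snd(2)[OF that] fst_eq[OF that] by simp
  \<comment> \<open>Both first components are the flow, so both second components solve one
    Lipschitz equation with the same forcing.\<close>
  have agree: "\<phi> t = \<psi> t" if \<phi>: "right_solution g (x, z) s \<phi>" and \<psi>: "right_solution g (x, z) s' \<psi>"
    and "s \<le> s'" "0 \<le> t" and t: "ereal t < s" for s s' \<phi> \<psi> t
  proof -
    have t': "ereal t < s'" using t \<open>s \<le> s'\<close> by simp
    have sub: "{0..t} \<subseteq> ?S s" "{0..t} \<subseteq> ?S s'"
      using t t' by (auto intro: le_less_trans[of "ereal _" "ereal _"])
    have "snd (\<phi> t) = snd (\<psi> t)"
    proof (rule lipschitz_ode_unique[OF \<open>0 \<le> t\<close> lip, where \<phi> = "\<lambda>t. snd (\<phi> t)"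
          and \<psi> = "\<lambda>t. snd (\<psi> t)" and c = "\<lambda>t. c (flow f x t)"])
      fix \<tau> assume \<tau>: "\<tau> \<in> {0..t}"
      show "((\<lambda>t. snd (\<phi> t)) has_vector_derivative F (snd (\<phi> \<tau>)) + c (flow f x \<tau>)) (at \<tau> within {0..t})"
        using \<tau> sub by (intro has_vector_derivative_within_subset[OF snd_deriv[OF \<phi>]]) auto
      show "((\<lambda>t. snd (\<psi> t)) has_vector_derivative F (snd (\<psi> \<tau>)) + c (flow f x \<tau>)) (at \<tau> within {0..t})"
        using \<tau> sub by (intro has_vector_derivative_within_subset[OF snd_deriv[OF \<psi>]]) auto
    next
      show "snd (\<phi> 0) = snd (\<psi> 0)"
        using \<phi> \<psi> by (auto simp: right_solution_def ivp_solution_def)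
    qed auto
    then show ?thesis
      using fst_eq[OF \<phi> \<open>0 \<le> t\<close> t] fst_eq[OF \<psi> \<open>0 \<le> t\<close> t'] by (simp add: prod_eq_iff)
  qed
  obtain Z where Z: "Z 0 = z" "\<And>t. 0 \<le> t \<Longrightarrow> ereal t < \<sigma> \<Longrightarrow>
      (Z has_vector_derivative F (Z t) + c (flow f x t)) (at t within ?S \<sigma>)"
    using lipschitz_ode_exists_half_open[OF lip _ continuous_on_subset[OF c S], of z]
      sigma_plus_pos[of x] by (auto simp: \<sigma>_def)
  define \<Phi> where "\<Phi> t = (flow f x t, Z t)" for t
  have "(\<Phi> has_vector_derivative g (\<Phi> t)) (at t within ?S \<sigma>)" if "t \<in> ?S \<sigma>" for t
  proof -
    have "(flow f x has_vector_derivative f (flow f x t)) (at t within ?S \<sigma>)"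
      using flow_has_vector_derivative S that by (blast intro: has_vector_derivative_at_within)
    then show ?thesis
      unfolding \<Phi>_def g_def using Z(2)[of t] that
      by (auto intro!: has_vector_derivative_Pair)
  qed
  then have \<Phi>: "right_solution g (x, z) \<sigma> \<Phi>"
    using sigma_plus_pos[of x] Z(1)
    by (auto simp: right_solution_def ivp_solution_def \<sigma>_def \<Phi>_def zero_ereal_def)
  then have "right_maximal_solution g (x, z) \<sigma> \<Phi>"
    using le by (fastforce simp: right_maximal_solution_def)
  then show "\<exists>s \<phi>. right_maximal_solution g (x, z) s \<phi>" by blast
  show s: "s = \<sigma>" if "right_maximal_solution g (x, z) s \<phi>" for s \<phi>
  proof (rule ccontr)
    assume "s \<noteq> \<sigma>"
    have \<phi>: "right_solution g (x, z) s \<phi>" using that by (simp add: right_maximal_solution_def)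
    then have "s < \<sigma>" using le \<open>s \<noteq> \<sigma>\<close> by (metis order_le_less)
    \<comment> \<open>The solution on the full interval would properly extend \<open>\<phi>\<close>,
      against its maximality.\<close>
    then show False
      using that \<Phi> agree[OF \<phi> \<Phi>] unfolding right_maximal_solution_def by force
  qed
  show "((\<lambda>t. snd (\<phi> t)) has_vector_derivative F (snd (\<phi> t)) + c (flow f x t)) (at t within ?S \<sigma>)"
    if "right_maximal_solution g (x, z) s \<phi>" "0 \<le> t" "ereal t < \<sigma>" for s \<phi> t
    using snd_deriv[of s \<phi> t] s[OF that(1)] that by (simp add: right_maximal_solution_def)
qed

section \<open>Diagonal matrices and left inverses\<close>

lemma has_vector_derivative_vec:
  fixes f :: "real \<Rightarrow> 'a::real_normed_vector ^ 'n"
  assumes "\<And>i. ((\<lambda>t. f t $ i) has_vector_derivative f' $ i) (at t within S)"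
  shows "(f has_vector_derivative f') (at t within S)"
  using assms unfolding has_vector_derivative_def has_derivative_within
  by (auto intro!: vec_tendstoI bounded_linear_scaleR_left)

lemma diagonal_matrix_mult_nth:
  assumes "diagonal_matrix M"
  shows "(M ** X) $ i $ j = M $ i $ i * X $ i $ j"
proof -
  have "(\<Sum>k\<in>UNIV. M $ i $ k * X $ k $ j) = (\<Sum>k\<in>UNIV. if k = i then M $ i $ i * X $ i $ j else 0)"
    using assms by (intro sum.cong) (auto simp: diagonal_matrix_def)
  then show ?thesis by (simp add: matrix_matrix_mult_def)
qed

lemma diagonal_matrix_scaleR: "diagonal_matrix A \<Longrightarrow> diagonal_matrix (k *\<^sub>R A)"
  by (simp add: diagonal_matrix_def)

text \<open>\<open>matrix_inv\<close> is a choice: exhibiting the inverse \<open>?E\<close> makes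
  the chosen matrix a two-sided inverse, and associativity identifies it with
  \<open>?E\<close>.\<close>

lemma matrix_inv_diagonal:
  assumes D: "diagonal_matrix D" and nz: "\<And>i. D $ i $ i \<noteq> 0"
  shows "matrix_inv D = (\<chi> i j. if i = j then 1 / D $ i $ i else 0)" (is "_ = ?E")
proof -
  have E: "diagonal_matrix ?E" by (simp add: diagonal_matrix_def)
  have DE: "D ** ?E = mat 1" "?E ** D = mat 1"
    using nz D unfolding vec_eq_iff diagonal_matrix_mult_nth[OF D] diagonal_matrix_mult_nth[OF E]
    by (auto simp: mat_def diagonal_matrix_def)
  then have "D ** matrix_inv D = mat 1 \<and> matrix_inv D ** D = mat 1"
    unfolding matrix_inv_def by (intro someI[of "\<lambda>X. D ** X = mat 1 \<and> X ** D = mat 1" ?E] conjI)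
  then have "matrix_inv D ** (D ** ?E) = ?E"
    by (simp add: matrix_mul_assoc)
  then show ?thesis
    unfolding DE(1) by simp
qed

lemma diagonal_matrix_mat_power:
  assumes "diagonal_matrix M"
  shows "diagonal_matrix (mat_power M n)" "mat_power M n $ i $ i = (M $ i $ i) ^ n"
proof (induction n)
  case 0
  { case 1 show ?case by (simp add: diagonal_matrix_def mat_def) }
  { case 2 show ?case by (simp add: mat_def) }
next
  case (Suc n)
  { case 1 show ?case using Suc.IH(1) by (simp add: diagonal_matrix_def diagonal_matrix_mult_nth[OF assms]) }
  { case 2 show ?case using Suc.IH(2) by (simp add: diagonal_matrix_mult_nth[OF assms]) }
qed

text \<open>The diagonal entries are eigenvalues, with the standard basis vectors as
  eigenvectors.\<close>

lemma hurwitz_diagonal: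
  assumes A: "diagonal_matrix A" and "hurwitz A"
  shows "Re (A $ i $ i) < 0"
proof -
  have "A *v axis i 1 = A $ i $ i *s axis i 1"
    using A by (auto simp: vec_eq_iff matrix_vector_mult_def axis_def diagonal_matrix_def
        if_distrib cong: if_cong)
  moreover have "axis i 1 \<noteq> (0 :: complex^'a)" by simp
  ultimately show ?thesis using \<open>hurwitz A\<close> unfolding hurwitz_def by blast
qed

lemma B1m_mult_rowvector: "B1m ** (rowvector v :: complex^'p^1) = (\<chi> i j. v $ j)"
  by (simp add: vec_eq_iff matrix_matrix_mult_def B1m_def columnvector_def rowvector_def)

text \<open>Each row is a combination of the Lie derivatives with powers of one number as weights.
  The sum is shifted to start at 0, so order \<open>l\<close> comes with the power
  \<open>Suc l\<close>.\<close>

lemma Ta_nth: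
  fixes A :: "complex^'m^'m" and b :: "real^'p \<Rightarrow> complex^'p"
  assumes A: "diagonal_matrix A" and nz: "\<And>i. A $ i $ i \<noteq> 0" and "k \<noteq> 0"
  shows "Ta f h b A k x $ i $ j =
    - (\<Sum>l<CARD('m). (1 / (of_real k * A $ i $ i)) ^ Suc l * lie_output f h b l x $ j)"
proof -
  have kA: "diagonal_matrix (k *\<^sub>R A)" by (rule diagonal_matrix_scaleR[OF A])
  let ?I = "matrix_inv (k *\<^sub>R A)"
  have I: "?I = (\<chi> i j. if i = j then 1 / (k *\<^sub>R A) $ i $ i else 0)"
    by (rule matrix_inv_diagonal[OF kA]) (use nz \<open>k \<noteq> 0\<close> in simp)
  then have dI: "diagonal_matrix ?I" by (simp add: diagonal_matrix_def)
  have "(k *\<^sub>R A) $ i $ i = of_real k * A $ i $ i"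
    by (simp only: vector_scaleR_component) (rule scaleR_conv_of_real)
  then have "?I $ i $ i = 1 / (of_real k * A $ i $ i)"
    unfolding I by (simp only: vec_lambda_beta simp_thms if_True)
  then have "(mat_power ?I l ** B1m ** (rowvector v :: complex^'p^1)) $ i $ j
      = (1 / (of_real k * A $ i $ i)) ^ l * v $ j" for l and v :: "complex^'p"
    by (simp add: diagonal_matrix_mult_nth[OF diagonal_matrix_mat_power(1)[OF dI]]
        diagonal_matrix_mat_power(2)[OF dI] B1m_mult_rowvector flip: matrix_mul_assoc)
  then show ?thesis
    by (simp add: Ta_def sum_component sum.atLeast1_atMost_eq del: power_Suc mat_power.simps)
qed

section \<open>The Vandermonde estimate\<close>

text \<open>The rank of an index is strictly increasing in it, hence injective into a set of equal
  size. It translates sums over rows into sums over orders of Lie derivatives.\<close>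

lemma bij_betw_card_lessThan:
  "bij_betw (\<lambda>l::'m::{finite,linorder}. card {..<l}) UNIV {..<CARD('m::{finite,linorder})}"
proof -
  let ?r = "\<lambda>l::'m. card {..<l}"
  have mono: "?r l < ?r l'" if "l < l'" for l l'
    using that by (intro psubset_card_mono) auto
  have inj: "inj ?r"
    by (rule injI) (metis mono less_irrefl neqE)
  have "?r l < CARD('m)" for l
    by (intro psubset_card_mono) auto
  then have "range ?r \<subseteq> {..<CARD('m)}" by auto
  moreover have "card (range ?r) = card {..<CARD('m)}"
    using inj by (simp add: card_image)
  ultimately show ?thesis
    using inj by (simp add: bij_betw_def card_subset_eq)
qed

lemma sum_card_lessThan:
  "(\<Sum>l\<in>UNIV. g (card {..<l::'m::{finite,linorder}})) = (\<Sum>l<CARD('m::{finite,linorder}). g l)"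
  by (rule sum.reindex_bij_betw[OF bij_betw_card_lessThan])

text \<open>A kernel vector with a nonzero entry would give, in the column of that entry, a nonzero
  polynomial of degree below \<open>CARD('m)\<close> with \<open>CARD('m)\<close> distinct roots. An
  injective linear map in finite dimension is bounded below.\<close>

lemma vandermonde_bounded_below:
  fixes \<mu> :: "'m::{finite,linorder} \<Rightarrow> complex"
  assumes "inj \<mu>" and nz: "\<And>i. \<mu> i \<noteq> 0"
  obtains B where "B > 0"
    "\<And>y :: complex^'p^('m::{finite,linorder}). B * norm y
      \<le> norm ((\<chi> i j. \<Sum>l\<in>UNIV. \<mu> i ^ Suc (card {..<l}) * y $ l $ j) :: complex^'p^('m::{finite,linorder}))"
proof -
  define W :: "complex^'p^('m::{finite,linorder}) \<Rightarrow> complex^'p^('m::{finite,linorder})"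
    where "W y = (\<chi> i j. \<Sum>l\<in>UNIV. \<mu> i ^ Suc (card {..<l}) * y $ l $ j)" for y
  have lin: "linear W"
    by (rule linearI)
      (simp_all add: W_def vec_eq_iff sum.distrib scaleR_sum_right algebra_simps)
  have "y = 0" if "W y = 0" for y
  proof -
    have "y $ l0 $ j = 0" for l0 j
    proof (rule ccontr)
      assume nonzero: "y $ l0 $ j \<noteq> 0"
      let ?r = "\<lambda>l::'m. card {..<l}"
      define c where "c n = y $ inv ?r n $ j" for n
      have inj: "inj ?r" and range: "\<And>l. ?r l < CARD('m)"
        using bij_betw_card_lessThan[where 'm='m] by (auto simp: bij_betw_def)
      have c: "c (?r l) = y $ l $ j" for l by (simp add: c_def inv_f_f[OF inj])
      \<comment> \<open>The degree bound: one less than the number of coefficients, and so one less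
        than the number of nodes.\<close>
      define n where "n = CARD('m) - 1"
      have n: "{..n} = {..<CARD('m)}"
        using zero_less_card_finite[where 'a='m] by (simp add: n_def flip: lessThan_Suc_atMost)
      have root: "(\<Sum>l\<le>n. c l * \<mu> i ^ l) = 0" for i
      proof -
        have "0 = W y $ i $ j" using that by simp
        also have "\<dots> = (\<Sum>l\<in>UNIV. \<mu> i ^ Suc (?r l) * c (?r l))"
          by (simp add: W_def c)
        also have "\<dots> = (\<Sum>l<CARD('m). \<mu> i ^ Suc l * c l)"
          by (rule sum_card_lessThan)
        \<comment> \<open>Powers start at 1 in \<open>W\<close>; the extra factor is pulled out and
          cancelled, since the nodes are nonzero.\<close>
        also have "\<dots> = \<mu> i * (\<Sum>l\<le>n. c l * \<mu> i ^ l)"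
          unfolding n sum_distrib_left by (simp add: mult_ac)
        finally show ?thesis using nz by simp
      qed
      have "\<exists>k\<le>n. c k \<noteq> 0"
        using c[of l0] range[of l0] nonzero by (intro exI[of _ "?r l0"]) (auto simp: n_def)
      then have fin: "finite {z. (\<Sum>l\<le>n. c l * z ^ l) = 0}"
        and card: "card {z. (\<Sum>l\<le>n. c l * z ^ l) = 0} \<le> n"
        using polyfun_rootbound by blast+
      have "card (range \<mu>) \<le> n"
        using card_mono[OF fin, of "range \<mu>"] root card by (meson image_subsetI le_trans mem_Collect_eq)
      then show False
        using \<open>inj \<mu>\<close> zero_less_card_finite[where 'a='m] unfolding n_def card_image[OF \<open>inj \<mu>\<close>]
        by linarith
    qed
    then show "y = 0" by (simp add: vec_eq_iff)
  qed
  then have "inj W" using lin by (simp add: linear_injective_0)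
  then show thesis
    using linear_inj_bounded_below_pos[OF lin] that unfolding W_def by blast
qed

text \<open>Only the row scaling depends on \<open>k\<close>: it is inverted at the cost of at most
  \<open>k ^ CARD('m)\<close>, since \<open>k \<ge> 1\<close>. The remaining Vandermonde matrix has
  the fixed nodes \<open>1 / A $ i $ i\<close>, so \<open>C\<close> does not depend on
  \<open>k\<close>.\<close>

lemma norm_obs_map_diff_le:
  fixes A :: "complex^('m::{finite,linorder})^('m::{finite,linorder})" and b :: "real^'q \<Rightarrow> complex^'q"
  assumes A: "diagonal_matrix A" and nz: "\<And>i. A $ i $ i \<noteq> 0" and inj: "inj (\<lambda>i. A $ i $ i)"
  obtains C where "C > 0"
    "\<And>k x1 x2. k \<ge> 1 \<Longrightarrow> norm (obs_map f h b x1 - obs_map f h b x2 :: complex^'q^('m::{finite,linorder}))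
        \<le> C * k ^ CARD('m::{finite,linorder}) * norm (Ta f h b A k x1 - Ta f h b A k x2)"
proof -
  define \<mu> where "\<mu> i = 1 / A $ i $ i" for i
  have "inj \<mu>" using inj by (auto simp: inj_def \<mu>_def)
  moreover have "\<mu> i \<noteq> 0" for i using nz by (simp add: \<mu>_def)
  ultimately obtain B where B: "B > 0"
    "\<And>y :: complex^'q^('m::{finite,linorder}). B * norm y
      \<le> norm ((\<chi> i j. \<Sum>l\<in>UNIV. \<mu> i ^ Suc (card {..<l}) * y $ l $ j) :: complex^'q^('m::{finite,linorder}))"
    by (rule vandermonde_bounded_below[of \<mu>]) blast+
  have "norm (obs_map f h b x1 - obs_map f h b x2 :: complex^'q^('m::{finite,linorder}))
      \<le> (1 / B) * k ^ CARD('m) * norm (Ta f h b A k x1 - Ta f h b A k x2)"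
    if k: "k \<ge> 1" for k x1 x2
  proof -
    define H where "H = (obs_map f h b x1 - obs_map f h b x2 :: complex^'q^('m::{finite,linorder}))"
    define y where "y = (\<chi> l j. of_real ((1 / k) ^ Suc (card {..<l})) * H $ l $ j)"
    have "norm (H $ l $ j) \<le> norm ((k ^ CARD('m) *\<^sub>R y) $ l $ j)" for l j
    proof -
      have "card {..<l} < CARD('m)" by (intro psubset_card_mono) auto
      then have "k ^ Suc (card {..<l}) \<le> k ^ CARD('m)"
        using k by (intro power_increasing) auto
      then have "1 \<le> k ^ CARD('m) * (1 / k) ^ Suc (card {..<l})"
        using k by (simp add: power_one_over divide_simps)
      then have "1 * norm (H $ l $ j) \<le> k ^ CARD('m) * (1 / k) ^ Suc (card {..<l}) * norm (H $ l $ j)"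
        by (rule mult_right_mono) simp
      then show ?thesis
        using k by (simp add: y_def norm_mult norm_power norm_divide)
    qed
    then have "norm H \<le> norm (k ^ CARD('m) *\<^sub>R y)"
      by (intro norm_le_componentwise_cart)
    then have "norm H \<le> k ^ CARD('m) * norm y" using k by simp
    moreover have "B * norm y \<le> norm (Ta f h b A k x1 - Ta f h b A k x2)"
    proof -
      \<comment> \<open>The points are exchanged here to absorb the minus sign in
        \<open>Ta\<close>.\<close>
      have "Ta f h b A k x2 $ i $ j - Ta f h b A k x1 $ i $ j
          = (\<Sum>l\<in>UNIV. \<mu> i ^ Suc (card {..<l}) * y $ l $ j)" for i j
      proof -
        let ?d = "\<lambda>l. lie_output f h b l x1 $ j - lie_output f h b l x2 $ j"
        have "Ta f h b A k x2 $ i $ j - Ta f h b A k x1 $ i $ j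
            = (\<Sum>l<CARD('m). (1 / (of_real k * A $ i $ i)) ^ Suc l * ?d l)"
          using k by (simp add: Ta_nth[OF A nz] sum_subtractf right_diff_distrib del: power_Suc)
        also have "\<dots> = (\<Sum>l<CARD('m). \<mu> i ^ Suc l * (of_real ((1 / k) ^ Suc l) * ?d l))"
          by (simp add: \<mu>_def power_divide power_mult_distrib mult_ac del: power_Suc)
        also have "\<dots> = (\<Sum>l\<in>UNIV. \<mu> i ^ Suc (card {..<l::'m})
            * (of_real ((1 / k) ^ Suc (card {..<l})) * ?d (card {..<l})))"
          by (rule sum_card_lessThan[symmetric])
        finally show ?thesis by (simp add: y_def H_def obs_map_def del: power_Suc)
      qed
      then have eq: "Ta f h b A k x2 - Ta f h b A k x1
          = (\<chi> i j. \<Sum>l\<in>UNIV. \<mu> i ^ Suc (card {..<l}) * y $ l $ j)"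
        by (simp add: vec_eq_iff)
      then show ?thesis
        using B(2)[of y] unfolding eq[symmetric] by (simp only: norm_minus_commute)
    qed
    ultimately have "norm H \<le> k ^ CARD('m) * (norm (Ta f h b A k x1 - Ta f h b A k x2) / B)"
      using B(1) k by (smt (verit) le_divide_eq mult.commute mult_left_mono zero_le_power)
    then show ?thesis by (simp add: H_def mult_ac)
  qed
  then show thesis using that[of "1 / B"] B(1) by simp
qed

text \<open>Row \<open>i\<close> has norm \<open>norm (a i) * norm v\<close>, and the Euclidean norm
  of the row norms is at most their sum.\<close>

lemma norm_outer_product_le:
  fixes a :: "'m::finite \<Rightarrow> complex" and v :: "complex^'p"
  shows "norm ((\<chi> i j. a i * v $ j) :: complex^'p^'m) \<le> (\<Sum>i\<in>UNIV. norm (a i)) * norm v"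
proof -
  have row: "norm ((\<chi> j. a i * v $ j) :: complex^'p) = norm (a i) * norm v" for i
    by (simp add: norm_vec_def norm_mult L2_set_right_distrib)
  have "norm ((\<chi> i j. a i * v $ j) :: complex^'p^'m) \<le> (\<Sum>i\<in>UNIV. norm ((\<chi> j. a i * v $ j) :: complex^'p))"
    unfolding norm_vec_def[of "\<chi> i j. a i * v $ j"] by (simp add: L2_set_le_sum)
  then show ?thesis by (simp add: row sum_distrib_right)
qed

text \<open>The image of \<open>T\<close> need not be closed, so a point outside it may be at distance zero from it;
  there the value is a limit of preimages.\<close>

lemma approximate_left_inverse:
  fixes T :: "'a::complete_space \<Rightarrow> 'b::metric_space" and r :: "real \<Rightarrow> real"
  assumes C: "closed C" "C \<noteq> {}"
    and r: "mono_on {0..} r" "r 0 = 0" "continuous_on {0..} r"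
    and le: "\<And>x y. x \<in> C \<Longrightarrow> y \<in> C \<Longrightarrow> dist x y \<le> r (dist (T x) (T y))"
  obtains S where "range S \<subseteq> C" "\<And>x. x \<in> C \<Longrightarrow> S (T x) = x"
    "\<And>x z. x \<in> C \<Longrightarrow> dist (S z) x \<le> r (3 * dist z (T x))"
proof -
  have mono: "r s \<le> r t" if "0 \<le> s" "s \<le> t" for s t
    using r(1) that by (auto simp: mono_on_def)
  have inj: "x = y" if "x \<in> C" "y \<in> C" "T x = T y" for x y
    using le[OF that(1,2)] that r(2) by simp
  have "\<exists>y\<in>C. (\<forall>x\<in>C. T x = z \<longrightarrow> y = x) \<and> (\<forall>x\<in>C. dist y x \<le> r (3 * dist z (T x)))" for z
  proof (cases "z \<in> T ` C")
    case True
    then obtain y where y: "y \<in> C" "T y = z" by auto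
    have "dist y x \<le> r (3 * dist z (T x))" if "x \<in> C" for x
    proof -
      have "dist y x \<le> r (dist z (T x))" using le[OF y(1) that] y by simp
      also have "\<dots> \<le> r (3 * dist z (T x))" by (rule mono) auto
      finally show ?thesis .
    qed
    then show ?thesis using y inj by blast
  next
    case False
    then have pos: "dist z (T x) > 0" if "x \<in> C" for x using that by auto
    let ?d = "infdist z (T ` C)"
    have ne: "T ` C \<noteq> {}" using C by simp
    have lower: "?d \<le> dist z (T x)" if "x \<in> C" for x
      using that by (intro infdist_le) auto
    have near: "\<exists>y\<in>C. dist z (T y) < a" if "?d < a" for a
    proof -
      have "(INF w\<in>T ` C. dist z w) < a" using that ne by (simp add: infdist_notempty)
      then show ?thesis using ne by (subst (asm) cINF_less_iff) auto
    qed
    have "\<exists>y\<in>C. \<forall>x\<in>C. dist y x \<le> r (3 * dist z (T x))"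
    \<comment> \<open>At positive distance, a point of the image within twice the distance exists;
      the triangle inequality then gives the factor 3 = 2 + 1.\<close>
    proof (cases "?d = 0")
      case False
      then have "?d < 2 * ?d" using infdist_nonneg[of z "T ` C"] by linarith
      then obtain y where y: "y \<in> C" "dist z (T y) < 2 * ?d" using near by blast
      have "dist y x \<le> r (3 * dist z (T x))" if "x \<in> C" for x
      proof -
        have "dist (T y) (T x) \<le> dist z (T y) + dist z (T x)" by (rule dist_triangle3)
        then have "dist (T y) (T x) \<le> 3 * dist z (T x)"
          using y(2) lower[OF that] by linarith
        then show ?thesis using le[OF y(1) that] mono[of "dist (T y) (T x)"] by fastforce
      qed
      then show ?thesis using y by blast
    next
      case True
      \<comment> \<open>At distance zero without attainment, a minimising sequence has images that
        cluster at \<open>z\<close>; smallness of \<open>r\<close> near 0 makes the sequence itself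
        Cauchy.\<close>
      then have "\<exists>y\<in>C. dist z (T y) < 1 / real (Suc n)" for n
        by (intro near) simp
      then obtain y where y: "\<And>n. y n \<in> C" "\<And>n. dist z (T (y n)) < 1 / real (Suc n)" by metis
      have small: "\<exists>d>0. \<forall>t. 0 \<le> t \<longrightarrow> t < d \<longrightarrow> r t < e" if "e > 0" for e
      proof -
        have "continuous (at 0 within {0..}) r"
          using r(3) by (simp add: continuous_on_eq_continuous_within)
        then obtain d where d: "d > 0" "\<And>t. t \<in> {0..} \<Longrightarrow> dist t 0 < d \<Longrightarrow> dist (r t) (r 0) < e"
          using \<open>e > 0\<close> unfolding continuous_within_eps_delta by metis
        have "r t < e" if "0 \<le> t" "t < d" for t
          using d(2)[of t] that r(2) by (simp add: dist_real_def)
        then show ?thesis using d(1) by blast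
      qed
      have "Cauchy y"
      proof (rule metric_CauchyI)
        fix e :: real assume "0 < e"
        then obtain d where d: "d > 0" "\<And>t. 0 \<le> t \<Longrightarrow> t < d \<Longrightarrow> r t < e" using small by metis
        obtain M where M: "1 / real (Suc M) < d / 2"
          using d(1) nat_approx_posE[of "d/2"] by auto
        have "dist (y m) (y n) < e" if "m \<ge> M" "n \<ge> M" for m n
        proof -
          have bound: "dist z (T (y n)) < d / 2" if "n \<ge> M" for n
          proof -
            have "1 / real (Suc n) \<le> 1 / real (Suc M)" using that by (simp add: frac_le)
            then show ?thesis using y(2)[of n] M by linarith
          qed
          have "dist (T (y m)) (T (y n)) \<le> dist z (T (y m)) + dist z (T (y n))" by (rule dist_triangle3)
          also have "\<dots> < d" using bound[OF that(1)] bound[OF that(2)] by linarith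
          finally have "r (dist (T (y m)) (T (y n))) < e" using d(2) by simp
          then show ?thesis using le[OF y(1)[of m] y(1)[of n]] by linarith
        qed
        then show "\<exists>M. \<forall>m\<ge>M. \<forall>n\<ge>M. dist (y m) (y n) < e" by blast
      qed
      then obtain l where l: "y \<longlonglongrightarrow> l" using Cauchy_convergent convergent_def by blast
      have "dist l x \<le> r (3 * dist z (T x))" if x: "x \<in> C" for x
      proof (rule tendsto_upperbound)
        show "(\<lambda>n. dist (y n) x) \<longlonglongrightarrow> dist l x" by (intro tendsto_intros l)
        \<comment> \<open>As \<open>z\<close> lies outside the image, \<open>dist z (T x)\<close> is
          positive and late terms of the sequence come closer to \<open>z\<close> than
          \<open>T x\<close>.\<close>
        obtain M where M: "1 / real (Suc M) < dist z (T x)"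
          using pos[OF x] nat_approx_posE by metis
        have "dist (y n) x \<le> r (3 * dist z (T x))" if "n \<ge> M" for n
        proof -
          have "1 / real (Suc n) \<le> 1 / real (Suc M)" using that by (simp add: frac_le)
          then have "dist z (T (y n)) \<le> dist z (T x)" using y(2)[of n] M by linarith
          then have "dist (T (y n)) (T x) \<le> 3 * dist z (T x)"
            using dist_triangle3[of "T (y n)" "T x" z] by (smt (verit) zero_le_dist)
          then show ?thesis using le[OF y(1) x, of n] mono[of "dist (T (y n)) (T x)"] by fastforce
        qed
        then show "\<forall>\<^sub>F n in sequentially. dist (y n) x \<le> r (3 * dist z (T x))"
          by (auto simp: eventually_sequentially)
      qed simp
      moreover have "l \<in> C" using C(1) y(1) l by (rule closed_sequentially)
      ultimately show ?thesis by blast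
    qed
    then show ?thesis using False by blast
  qed
  then obtain S where "\<And>z. S z \<in> C \<and> (\<forall>x\<in>C. T x = z \<longrightarrow> S z = x) \<and>
      (\<forall>x\<in>C. dist (S z) x \<le> r (3 * dist z (T x)))"
    by metis
  then show thesis by (intro that[of S]) auto
qed

section \<open>The observer\<close>

context locally_lipschitz_field
begin

lemma lie_iter_flow_has_vector_derivative:
  assumes "lie_differentiable f (lie_iter f i V)" "t \<in> max_ivl f UNIV x"
  shows "((\<lambda>t. lie_iter f i V (flow f x t)) has_vector_derivative lie_iter f (Suc i) V (flow f x t)) (at t)"
  using lie_differentiable_imp_has_vector_derivative[OF assms] by (simp add: lie_iter_def)

end

text \<open>Differentiation raises each Lie order by one, and multiplication by \<open>k a_i\<close>
  lowers each power by one, where \<open>a_i\<close> is the diagonal entry. The sums telescope,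
  leaving order 0, the injected output, and order \<open>CARD('m)\<close>, the term that
  \<open>F\<close> must reproduce.\<close>

lemma Ta_flow_has_vector_derivative:
  fixes f :: "real^'n \<Rightarrow> real^'n" and A :: "complex^'m^'m" and b :: "real^'p \<Rightarrow> complex^'p"
  assumes f: "local_lipschitz (UNIV :: real set) UNIV (\<lambda>_. f)"
    and smooth: "\<And>i j. i < CARD('m) \<Longrightarrow> lie_differentiable f (lie_iter f i (\<lambda>x. b (h x) $ j))"
    and A: "diagonal_matrix A" and nz: "\<And>i. A $ i $ i \<noteq> 0" and k: "k \<noteq> 0"
    and t: "t \<in> max_ivl f UNIV x"
  shows "((\<lambda>t. Ta f h b A k (flow f x t)) has_vector_derivative
      (k *\<^sub>R A) ** Ta f h b A k (flow f x t) + B1m ** (rowvector (b (h (flow f x t))) :: complex^'p^1)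
      - (\<chi> i j. (1 / (of_real k * A $ i $ i)) ^ CARD('m) * lie_output f h b CARD('m) (flow f x t) $ j))
      (at t)"
proof -
  interpret locally_lipschitz_field f by unfold_locales (rule f)
  let ?y = "flow f x t"
  have deriv: "((\<lambda>t. Ta f h b A k (flow f x t) $ i $ j) has_vector_derivative
      of_real k * A $ i $ i * Ta f h b A k ?y $ i $ j + b (h ?y) $ j
      - (1 / (of_real k * A $ i $ i)) ^ CARD('m) * lie_output f h b CARD('m) ?y $ j) (at t)" for i j
  proof -
    define q where "q = 1 / (of_real k * A $ i $ i)"
    define a where "a l = lie_output f h b l ?y $ j" for l
    have q: "of_real k * A $ i $ i * q = 1" using k nz by (simp add: q_def)
    have "((\<lambda>t. lie_output f h b l (flow f x t) $ j) has_vector_derivative a (Suc l)) (at t)"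
      if "l < CARD('m)" for l
      using lie_iter_flow_has_vector_derivative[OF smooth[OF that] t]
      by (simp add: lie_output_def a_def)
    then have "((\<lambda>t. - (\<Sum>l<CARD('m). q ^ Suc l * lie_output f h b l (flow f x t) $ j))
        has_vector_derivative - (\<Sum>l<CARD('m). q ^ Suc l * a (Suc l))) (at t)"
      by (intro has_vector_derivative_minus has_vector_derivative_sum has_vector_derivative_mult_right) auto
    moreover have "- (\<Sum>l<n. q ^ Suc l * a (Suc l))
        = of_real k * A $ i $ i * - (\<Sum>l<n. q ^ Suc l * a l) + a 0 - q ^ n * a n" for n
    proof (induction n)
      case (Suc n)
      have "of_real k * A $ i $ i * (q ^ Suc n * a n) = q ^ n * a n"
        using q by (simp add: mult_ac)
      then show ?case
        using Suc.IH
        unfolding sum.lessThan_Suc minus_add_distrib distrib_left mult_minus_right by simp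
    qed simp
    ultimately show ?thesis
      using k by (simp add: Ta_nth[OF A nz] q_def a_def lie_output_def lie_iter_def del: power_Suc)
  qed
  have kA: "((k *\<^sub>R A) ** X) $ i $ j = of_real k * A $ i $ i * X $ i $ j" for i j and X :: "complex^'p^'m"
  proof -
    have "(k *\<^sub>R A) $ i $ i = of_real k * A $ i $ i"
      by (simp only: vector_scaleR_component) (rule scaleR_conv_of_real)
    then show ?thesis by (simp only: diagonal_matrix_mult_nth[OF diagonal_matrix_scaleR[OF A]])
  qed
  show ?thesis
    by (intro has_vector_derivative_vec)
      (simp only: vector_minus_component vector_add_component vec_lambda_beta kA B1m_mult_rowvector deriv)
qed

text \<open>In the real inner product on the complex plane, only the real part of a multiplier
  contributes to the product of a number with its multiple.\<close>

lemma inner_diagonal_hurwitz_le: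
  fixes A :: "complex^'m^'m" and e :: "complex^'p^'m"
  assumes A: "diagonal_matrix A" and \<alpha>: "\<And>i. Re (A $ i $ i) \<le> - \<alpha>" and "k \<ge> 0"
  shows "e \<bullet> ((k *\<^sub>R A) ** e) \<le> - (k * \<alpha>) * (norm e)\<^sup>2"
proof -
  have "e $ i $ j \<bullet> ((k *\<^sub>R A) ** e) $ i $ j \<le> - (k * \<alpha>) * (e $ i $ j \<bullet> e $ i $ j)" for i j
  proof -
    have "((k *\<^sub>R A) ** e) $ i $ j = k *\<^sub>R (A $ i $ i * e $ i $ j)"
      by (simp only: diagonal_matrix_mult_nth[OF diagonal_matrix_scaleR[OF A]]
          vector_scaleR_component mult_scaleR_left)
    then have "e $ i $ j \<bullet> ((k *\<^sub>R A) ** e) $ i $ j = k * (Re (A $ i $ i) * (e $ i $ j \<bullet> e $ i $ j))"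
      by (simp add: inner_complex_def algebra_simps)
    also have "\<dots> \<le> k * (- \<alpha> * (e $ i $ j \<bullet> e $ i $ j))"
      using \<alpha> \<open>k \<ge> 0\<close> by (intro mult_left_mono mult_right_mono) auto
    finally show ?thesis by simp
  qed
  then have "(\<Sum>i\<in>UNIV. \<Sum>j\<in>UNIV. e $ i $ j \<bullet> ((k *\<^sub>R A) ** e) $ i $ j)
      \<le> (\<Sum>i\<in>UNIV. \<Sum>j\<in>UNIV. - (k * \<alpha>) * (e $ i $ j \<bullet> e $ i $ j))"
    by (intro sum_mono)
  then show ?thesis
    by (simp only: inner_vec_def power2_norm_eq_inner sum_distrib_left)
qed

text \<open>Distinct diagonal entries make the Vandermonde matrix invertible, and
  \<open>\<O> \<noteq> {}\<close> leaves \<open>Tstar\<close> a set to map into. Existence of a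
  right maximal solution is asserted so that the claims about all such solutions are not vacuous.
  Composition with \<open>real_of_ereal\<close> expresses the limit at a finite or infinite end time
  in one formula.\<close>

theorem corollary2p12:
  fixes f :: "real^'n \<Rightarrow> real^'n"
    and h :: "real^'n \<Rightarrow> real^'p"
    and \<O> :: "(real^'n) set"
    and b :: "real^'p \<Rightarrow> complex^'p"
    and \<rho> :: "real \<Rightarrow> real"
    and L :: real
    and A :: "complex^('m::{finite,linorder})^('m::{finite,linorder})"
  assumes f_lipschitz: "local_lipschitz (UNIV :: real set) UNIV (\<lambda>_. f)"
    and h_lipschitz: "local_lipschitz (UNIV :: real set) UNIV (\<lambda>_. h)"
    and lie_smooth: "\<And>i j. i < CARD('m::{finite,linorder}) \<Longrightarrow>
      lie_differentiable f (lie_iter f i (\<lambda>x. b (h x) $ j))"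
    and "open \<O>" and "\<O> \<noteq> {}"
    and "forward_complete_within f \<O>"
    and "class_K_infinity \<rho>" and "L > 0"
    and "\<And>x1 x2. x1 \<in> closure \<O> \<Longrightarrow> x2 \<in> closure \<O> \<Longrightarrow>
      norm (lie_output f h b (CARD('m::{finite,linorder})) x1 - lie_output f h b (CARD('m::{finite,linorder})) x2)
        \<le> L * norm (obs_map f h b x1 - obs_map f h b x2 :: complex^'p^('m::{finite,linorder}))"
    and "\<And>x1 x2. x1 \<in> closure \<O> \<Longrightarrow> x2 \<in> closure \<O> \<Longrightarrow>
      norm (x1 - x2) \<le> \<rho> (norm (obs_map f h b x1 - obs_map f h b x2 :: complex^'p^('m::{finite,linorder})))"
    and "diagonal_matrix A" and "hurwitz A" and "inj (\<lambda>i. A $ i $ i)"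
  shows "\<exists>kstar::real. \<forall>k>kstar. \<exists>Tstar F.
    range Tstar \<subseteq> closure \<O> \<and>
    (\<forall>x\<in>closure \<O>. Tstar (Ta f h b A k x) = x) \<and>
    (\<forall>x\<in>\<O>. \<forall>z.
      (\<exists>s \<phi>. right_maximal_solution (coupled_field f h b A k F) (x, z) s \<phi>) \<and>
      (\<forall>s \<phi>. right_maximal_solution (coupled_field f h b A k F) (x, z) s \<phi> \<longrightarrow>
        s = sigma_plus f UNIV x \<and>
        (sigma_plus f \<O> x = sigma_plus f UNIV x \<longrightarrow>
          (((\<lambda>t. norm (Tstar (snd (\<phi> t)) - flow f x t)) \<circ> real_of_ereal) \<longlongrightarrow> 0)
            (at_left (sigma_plus f UNIV x)))))"
proof -
  note f_lip = assms(1) and smooth = assms(3) and \<O>_open = assms(4) and \<O>_ne = assms(5)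
    and complete = assms(6) and \<rho> = assms(7) and L_pos = assms(8) and Lip_H = assms(9)
    and \<rho>_H = assms(10) and A = assms(11) and hurwitz = assms(12) and inj = assms(13)
  interpret locally_lipschitz_field f by unfold_locales (rule f_lip)
  let ?m = "CARD('m)" and ?C = "closure \<O>"
  let ?H = "obs_map f h b :: real^'n \<Rightarrow> complex^'p^('m::{finite,linorder})"
  have Re_neg: "Re (A $ i $ i) < 0" for i by (rule hurwitz_diagonal[OF A hurwitz])
  then have nz: "A $ i $ i \<noteq> 0" for i by (metis less_irrefl zero_complex.simps(1))
  \<comment> \<open>The slowest decay rate among the modes of \<open>A\<close>.\<close>
  define \<alpha> where "\<alpha> = Min (range (\<lambda>i. - Re (A $ i $ i)))"
  have \<alpha>_pos: "\<alpha> > 0" unfolding \<alpha>_def using Re_neg by (subst Min_gr_iff) auto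
  have "\<alpha> \<le> - Re (A $ i $ i)" for i
    unfolding \<alpha>_def by (intro Min_le) auto
  then have \<alpha>: "Re (A $ i $ i) \<le> - \<alpha>" for i
    by (simp only: le_minus_iff)
  obtain C where C: "C > 0" "\<And>k x1 x2. k \<ge> 1 \<Longrightarrow> norm (?H x1 - ?H x2)
      \<le> C * k ^ ?m * norm (Ta f h b A k x1 - Ta f h b A k x2)"
    using norm_obs_map_diff_le[OF A nz inj] by blast
  define D where "D = (\<Sum>i\<in>UNIV. norm ((1 / A $ i $ i) ^ ?m))"
  have D: "D \<ge> 0" unfolding D_def by (intro sum_nonneg) auto
  \<comment> \<open>The Lipschitz constant of the extended \<open>F\<close>, including the dimension
    factor of the extension; it is fixed before \<open>k\<close> is chosen.\<close>
  define N where "N = real DIM(complex^'p^('m::{finite,linorder})) * (D * L * C)"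
  have \<rho>_props: "continuous_on {0..} \<rho>" "mono_on {0..} \<rho>" "\<rho> 0 = 0"
    using \<rho> by (auto simp: class_K_infinity_def strict_mono_on_imp_mono_on)
  show ?thesis
  \<comment> \<open>The bound 1 serves the estimate of \<open>H\<close> by \<open>T_a\<close>;
    \<open>N / \<alpha>\<close> makes the decay rate \<open>k * \<alpha>\<close> exceed the
    Lipschitz constant \<open>N\<close>.\<close>
  proof (intro exI[of _ "max 1 (N / \<alpha>)"] allI impI)
    fix k :: real assume "max 1 (N / \<alpha>) < k"
    then have k: "k \<ge> 1" "k > 0" "k \<noteq> 0" and gain: "N < k * \<alpha>"
      using \<alpha>_pos by (auto simp: divide_simps)
    let ?T = "Ta f h b A k"
    define Ck where "Ck = C * k ^ ?m"
    have Ck: "Ck > 0" using C(1) k by (simp add: Ck_def)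
    define r where r: "r s = \<rho> (Ck * s)" for s
    have r_mono: "mono_on {0..} r"
      using \<rho>_props(2) Ck by (auto simp: mono_on_def r)
    have r_cont: "continuous_on {0..} r"
      unfolding r using Ck by (intro continuous_on_compose2[OF \<rho>_props(1)] continuous_intros) auto
    have r0: "r 0 = 0" using \<rho>_props by (simp add: r)
    have dist_le: "dist x1 x2 \<le> r (dist (?T x1) (?T x2))" if "x1 \<in> ?C" "x2 \<in> ?C" for x1 x2
    proof -
      have "norm (x1 - x2) \<le> \<rho> (norm (?H x1 - ?H x2))" by (rule \<rho>_H[OF that])
      also have "\<dots> \<le> \<rho> (Ck * norm (?T x1 - ?T x2))"
        using C(2)[OF k(1), of x1 x2] Ck by (intro mono_onD[OF \<rho>_props(2)]) (auto simp: Ck_def)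
      finally show ?thesis by (simp add: dist_norm r)
    qed
    obtain Tstar where Tstar: "range Tstar \<subseteq> ?C" "\<And>x. x \<in> ?C \<Longrightarrow> Tstar (?T x) = x"
      "\<And>x z. x \<in> ?C \<Longrightarrow> dist (Tstar z) x \<le> r (3 * dist z (?T x))"
      using approximate_left_inverse[OF closed_closure _ r_mono r0 r_cont dist_le] \<O>_ne by auto
    \<comment> \<open>The order \<open>CARD('m)\<close> term in the derivative of \<open>T_a\<close>
      along the flow, read as a function of \<open>z\<close> through \<open>Tstar\<close>.\<close>
    define F0 :: "complex^'p^('m::{finite,linorder}) \<Rightarrow> complex^'p^('m::{finite,linorder})" where
      "F0 z = - (\<chi> i j. (1 / (of_real k * A $ i $ i)) ^ ?m * lie_output f h b ?m (Tstar z) $ j)" for z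
    have "(D * L * C)-lipschitz_on (?T ` ?C) F0"
    proof (rule lipschitz_onI)
      show "0 \<le> D * L * C" using D L_pos C by simp
      fix z1 z2 assume "z1 \<in> ?T ` ?C" "z2 \<in> ?T ` ?C"
      then obtain x1 x2 where x: "x1 \<in> ?C" "x2 \<in> ?C" "z1 = ?T x1" "z2 = ?T x2" by auto
      let ?d = "lie_output f h b ?m x1 - lie_output f h b ?m x2"
      have "F0 z2 - F0 z1 = (\<chi> i j. (1 / (of_real k * A $ i $ i)) ^ ?m * ?d $ j)"
        unfolding F0_def x(3,4) Tstar(2)[OF x(1)] Tstar(2)[OF x(2)]
        by (simp add: vec_eq_iff right_diff_distrib)
      then have "norm (F0 z2 - F0 z1) \<le> (\<Sum>i\<in>UNIV. norm ((1 / (of_real k * A $ i $ i)) ^ ?m)) * norm ?d"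
        by (simp only: norm_outer_product_le)
      also have "(\<Sum>i\<in>UNIV. norm ((1 / (of_real k * A $ i $ i)) ^ ?m)) = D / k ^ ?m"
        using k by (simp add: D_def sum_divide_distrib norm_mult norm_divide norm_power power_mult_distrib
            power_divide mult.commute)
      also have "D / k ^ ?m * norm ?d \<le> D / k ^ ?m * (L * (C * k ^ ?m * norm (z1 - z2)))"
      proof (intro mult_left_mono)
        have "norm ?d \<le> L * norm (?H x1 - ?H x2)" by (rule Lip_H[OF x(1,2)])
        also have "\<dots> \<le> L * (C * k ^ ?m * norm (z1 - z2))"
          using C(2)[OF k(1), of x1 x2] L_pos x by (intro mult_left_mono) auto
        finally show "norm ?d \<le> L * (C * k ^ ?m * norm (z1 - z2))" .
      qed (use D k in auto)
      also have "\<dots> = D * L * C * norm (z1 - z2)" using k by simp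
      finally show "dist (F0 z1) (F0 z2) \<le> D * L * C * dist z1 z2"
        by (simp add: dist_norm norm_minus_commute)
    qed
    then obtain F where F_lip: "N-lipschitz_on UNIV F" and F_eq: "\<And>z. z \<in> ?T ` ?C \<Longrightarrow> F z = F0 z"
      unfolding N_def by (rule lipschitz_extension) blast
    define G where "G z = (k *\<^sub>R A) ** z + F z" for z
    have kA_linear: "linear (\<lambda>z :: complex^'p^('m::{finite,linorder}). (k *\<^sub>R A) ** z)"
      by (rule linearI) (simp_all only: vec_eq_iff diagonal_matrix_mult_nth[OF diagonal_matrix_scaleR[OF A]]
          vector_add_component vector_scaleR_component distrib_left mult_scaleR_right simp_thms)
    obtain K where "K-lipschitz_on UNIV (\<lambda>z :: complex^'p^('m::{finite,linorder}). (k *\<^sub>R A) ** z)"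
      using kA_linear bounded_linear.lipschitz_boundE linear_conv_bounded_linear by blast
    then have G_lip: "(K + N)-lipschitz_on UNIV G"
      unfolding G_def by (intro lipschitz_on_add F_lip)
    define c :: "real^'n \<Rightarrow> complex^'p^('m::{finite,linorder})"
      where "c y = B1m ** (rowvector (b (h y)) :: complex^'p^1)" for y
    \<comment> \<open>Continuity of the output along the flow is taken from Lie differentiability at
      order 0.\<close>
    have c_cont: "continuous_on (max_ivl f UNIV x) (\<lambda>t. c (flow f x t))" for x
    proof -
      have "continuous_on (max_ivl f UNIV x) (\<lambda>t. b (h (flow f x t)) $ j)" for j
      proof (rule continuous_at_imp_continuous_on, rule ballI)
        fix t assume "t \<in> max_ivl f UNIV x"
        then have "((\<lambda>t. lie_iter f 0 (\<lambda>x. b (h x) $ j) (flow f x t)) has_vector_derivative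
            lie_iter f (Suc 0) (\<lambda>x. b (h x) $ j) (flow f x t)) (at t)"
          by (intro lie_iter_flow_has_vector_derivative smooth) auto
        then show "isCont (\<lambda>t. b (h (flow f x t)) $ j) t"
          using has_vector_derivative_continuous by (fastforce simp: lie_iter_def)
      qed
      then show ?thesis
        unfolding c_def B1m_mult_rowvector by (intro continuous_on_vec_lambda)
    qed
    have field: "coupled_field f h b A k F = (\<lambda>(x, z). (f x, G z + c x))"
      by (simp add: coupled_field_def G_def c_def fun_eq_iff)
    have converges: "((\<lambda>t. norm (Tstar (snd (\<phi> t)) - flow f x t)) \<longlongrightarrow> 0) at_top"
      if in_\<O>: "\<And>t. 0 \<le> t \<Longrightarrow> t \<in> max_ivl f UNIV x \<and> flow f x t \<in> \<O>"
        and deriv: "\<And>t. 0 \<le> t \<Longrightarrow> ((\<lambda>t. snd (\<phi> t)) has_vector_derivative G (snd (\<phi> t)) + c (flow f x t))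
          (at t within {0..})"
      for x and \<phi> :: "real \<Rightarrow> (real^'n) \<times> (complex^'p^('m::{finite,linorder}))"
    proof -
      define e where "e t = snd (\<phi> t) - ?T (flow f x t)" for t
      have in_C: "flow f x t \<in> ?C" if "0 \<le> t" for t
        using in_\<O>[OF that] closure_subset by blast
      \<comment> \<open>On the closure of \<open>\<O>\<close> the curve
        \<open>?T (flow f x t)\<close> solves the observer equation, so the injected output cancels
        in the error. Then \<open>k *\<^sub>R A\<close> contributes \<open>- k * \<alpha>\<close> to
        the rate and \<open>F\<close> at most \<open>N\<close>.\<close>
      have e_le: "norm (e T) \<le> exp ((N - k * \<alpha>) * T) * norm (e 0)" if "0 \<le> T" for T
      proof (rule norm_le_exp_of_inner_le[OF that])
        fix t assume t: "t \<in> {0..T}"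
        let ?y = "flow f x t"
        let ?e' = "(k *\<^sub>R A) ** e t + (F (snd (\<phi> t)) - F (?T ?y))"
        have "(k *\<^sub>R A) ** e t = (k *\<^sub>R A) ** snd (\<phi> t) - (k *\<^sub>R A) ** ?T ?y"
          unfolding e_def by (rule linear_diff[OF kA_linear])
        moreover have "F (?T ?y) = - (\<chi> i j. (1 / (of_real k * A $ i $ i)) ^ ?m * lie_output f h b ?m ?y $ j)"
          using F_eq[of "?T ?y"] in_C[of t] t Tstar(2) by (simp add: F0_def)
        ultimately have e': "?e' = G (snd (\<phi> t)) + c ?y - ((k *\<^sub>R A) ** ?T ?y + B1m ** (rowvector (b (h ?y)) :: complex^'p^1)
            - (\<chi> i j. (1 / (of_real k * A $ i $ i)) ^ ?m * lie_output f h b ?m ?y $ j))"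
          by (simp add: G_def c_def)
        have "t \<in> max_ivl f UNIV x" using in_\<O>[of t] t by simp
        note T' = has_vector_derivative_at_within[OF
            Ta_flow_has_vector_derivative[OF f_lip smooth A nz k(3) this]]
        have "((\<lambda>t. snd (\<phi> t)) has_vector_derivative G (snd (\<phi> t)) + c ?y) (at t within {0..T})"
          by (rule has_vector_derivative_within_subset[OF deriv]) (use t in auto)
        then show "(e has_vector_derivative ?e') (at t within {0..T})"
          unfolding e' unfolding e_def[abs_def] by (rule has_vector_derivative_diff) (rule T')
        have "e t \<bullet> (F (snd (\<phi> t)) - F (?T ?y)) \<le> norm (e t) * norm (F (snd (\<phi> t)) - F (?T ?y))"
          by (rule norm_cauchy_schwarz)
        also have "\<dots> \<le> norm (e t) * (N * norm (e t))"
          unfolding e_def using lipschitz_on_normD[OF F_lip] by (intro mult_left_mono) auto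
        finally show "e t \<bullet> ?e' \<le> (N - k * \<alpha>) * (norm (e t))\<^sup>2"
          using inner_diagonal_hurwitz_le[OF A \<alpha>, of k "e t"] k
          by (simp add: inner_add_right algebra_simps power2_eq_square)
      qed
      have "((\<lambda>t. exp ((N - k * \<alpha>) * t) * norm (e 0)) \<longlongrightarrow> 0) at_top"
      proof -
        have "filterlim (\<lambda>t. (N - k * \<alpha>) * t) at_bot at_top"
          using gain by (intro filterlim_tendsto_neg_mult_at_bot[OF tendsto_const _ filterlim_ident]) auto
        then have "((\<lambda>t. exp ((N - k * \<alpha>) * t)) \<longlongrightarrow> 0) at_top"
          by (rule filterlim_compose[OF exp_at_bot])
        then show ?thesis by (rule tendsto_mult_left_zero)
      qed
      moreover have "\<forall>\<^sub>F t in at_top. norm (norm (e t)) \<le> exp ((N - k * \<alpha>) * t) * norm (e 0)"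
        by (rule eventually_mono[OF eventually_ge_at_top[of 0]]) (simp add: e_le)
      ultimately have "((\<lambda>t. norm (e t)) \<longlongrightarrow> 0) at_top"
        by (rule Lim_null_comparison[rotated])
      then have lim3: "((\<lambda>t. 3 * norm (e t)) \<longlongrightarrow> 0) at_top"
        by (rule tendsto_mult_right_zero)
      have "((\<lambda>t. r (3 * norm (e t))) \<longlongrightarrow> r 0) at_top"
        by (rule continuous_on_tendsto_compose[OF r_cont lim3]) auto
      then have "((\<lambda>t. r (3 * norm (e t))) \<longlongrightarrow> 0) at_top" by (simp add: r0)
      moreover have "\<forall>\<^sub>F t in at_top. norm (norm (Tstar (snd (\<phi> t)) - flow f x t)) \<le> r (3 * norm (e t))"
        using eventually_ge_at_top[of 0]
      proof (rule eventually_mono)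
        fix t :: real assume "0 \<le> t"
        then show "norm (norm (Tstar (snd (\<phi> t)) - flow f x t)) \<le> r (3 * norm (e t))"
          using Tstar(3)[OF in_C, of t "snd (\<phi> t)"] by (simp add: e_def dist_norm)
      qed
      ultimately show ?thesis
        by (rule Lim_null_comparison[rotated])
    qed
    show "\<exists>Tstar F. range Tstar \<subseteq> ?C \<and> (\<forall>x\<in>?C. Tstar (?T x) = x) \<and>
      (\<forall>x\<in>\<O>. \<forall>z.
        (\<exists>s \<phi>. right_maximal_solution (coupled_field f h b A k F) (x, z) s \<phi>) \<and>
        (\<forall>s \<phi>. right_maximal_solution (coupled_field f h b A k F) (x, z) s \<phi> \<longrightarrow>
          s = sigma_plus f UNIV x \<and>
          (sigma_plus f \<O> x = sigma_plus f UNIV x \<longrightarrow>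
            (((\<lambda>t. norm (Tstar (snd (\<phi> t)) - flow f x t)) \<circ> real_of_ereal) \<longlongrightarrow> 0)
              (at_left (sigma_plus f UNIV x)))))"
    proof (intro exI[of _ Tstar] exI[of _ F] conjI ballI allI impI)
      fix x z assume x: "x \<in> \<O>"
      show "\<exists>s \<phi>. right_maximal_solution (coupled_field f h b A k F) (x, z) s \<phi>"
        unfolding field by (rule right_maximal_solution_cascade(1)[OF G_lip c_cont])
      fix s \<phi> assume \<phi>: "right_maximal_solution (coupled_field f h b A k F) (x, z) s \<phi>"
      then show "s = sigma_plus f UNIV x"
        unfolding field by (rule right_maximal_solution_cascade(2)[OF G_lip c_cont])
      assume eq: "sigma_plus f \<O> x = sigma_plus f UNIV x"
      \<comment> \<open>If finite, \<open>sigma_plus f \<O> x\<close> would be strictly below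
        \<open>sigma_plus f UNIV x\<close>, contradicting \<open>eq\<close>.\<close>
      then have inf: "sigma_plus f UNIV x = \<infinity>"
        using complete x unfolding forward_complete_within_def by (metis ereal_infty_less(1) less_irrefl)
      have "((\<lambda>t. norm (Tstar (snd (\<phi> t)) - flow f x t)) \<longlongrightarrow> 0) at_top"
      proof (rule converges)
        fix t :: real assume t: "0 \<le> t"
        show "t \<in> max_ivl f UNIV x \<and> flow f x t \<in> \<O>"
          using less_sigma_plus_iff[OF t, of x] flow_in_of_sigma_plus_eq[OF eq t] inf by simp
        show "((\<lambda>t. snd (\<phi> t)) has_vector_derivative G (snd (\<phi> t)) + c (flow f x t)) (at t within {0..})"
          using right_maximal_solution_cascade(3)[OF G_lip c_cont \<phi>[unfolded field] t] inf
          by (simp add: atLeast_def)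
      qed
      \<comment> \<open>At an infinite end time, the left limit over extended reals is the limit at
        \<open>at_top\<close>.\<close>
      then show "(((\<lambda>t. norm (Tstar (snd (\<phi> t)) - flow f x t)) \<circ> real_of_ereal) \<longlongrightarrow> 0)
          (at_left (sigma_plus f UNIV x))"
        unfolding inf ereal_tendsto_simps1 .
    qed (use Tstar in auto)
  qed
qed

end
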